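(* Let $B\in L^2([-1,1])$ be real-valued with $B\ge 0$ and $B\not\equiv 0$ (as an element of $L^2$), let $T>0$, and let $G^c, G^c_N, p^c, p^c_N, S_NB$ be the functions associated with $B$ as defined in the context. (i) For every $t\in[0,T]$, $$\|G^c(t,\cdot)-G^c_N(t,\cdot)\|_2+\|p^c(t,\cdot)-p^c_N(t,\cdot)\|_1\to 0\quad\text{as } N\to\infty .$$ (ii) Suppose additionally that the Legendre projections of $B$ converge uniformly to $B$, i.e. $\|B-S_NB\|_\infty\to 0$ as $N\to\infty$. Then for every $N\geq 0$ and every $t\in[0,T]$, $$\|G^c(t,\cdot)-G^c_N(t,\cdot)\|_\infty\le T\,\|B-S_NB\|_\infty+\pi T^2\,\|B-S_NB\|_2^2 ,$$ and the right-hand side tends to $0$ as $N\to\infty$. Moreover, for each $\delta\in(0,T)$ there exists $N$ such that for all $n>N$, all $t\in[\delta,T]$ and all $\mu\in[-1,1]$ one has $G^c_n(t,\mu)>0$, and thus $p^c_n(t,\mu)>0$.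
   Context: All norms $\|\cdot\|_1,\|\cdot\|_2,\|\cdot\|_\infty$ are the $L^1,L^2,L^\infty$ norms on $[-1,1]$ with respect to Lebesgue measure $d\mu$ in the variable $\mu$ (for fixed $t$). $P_\ell$ denotes the Legendre polynomial of degree $\ell$ with $P_\ell(1)=1$. Here $B=B(\mu)$ is the angular collision kernel of the Boltzmann equation at a fixed relative speed $|q|$, the dependence on $|q|$ being suppressed. Its Legendre expansion is $B=\sum_{\ell=0}^\infty B_\ell P_\ell$ in $L^2([-1,1])$, with $B_\ell=\frac{2\ell+1}{2}\int_{-1}^1 B(\mu)P_\ell(\mu)\,d\mu$, and its Legendre projections are $$S_NB(\mu)=\sum_{\ell=0}^N B_\ell P_\ell(\mu).$$ Define $$\lambda_\ell=2\pi\int_{-1}^1 B(\mu)\,(1-P_\ell(\mu))\,d\mu\ (\ge 0),\qquad K=\lim_{\ell\to\infty}\lambda_\ell=2\pi\int_{-1}^1B(\mu)\,d\mu=4\pi B_0 .$$ For $t\ge 0$, the continuous component of the Green's function and its truncation of order $N$ are $$G^c(t,\mu)=\sum_{\ell=0}^{\infty}\frac{2\ell+1}{4\pi}\left(e^{-\lambda_\ell t}-e^{-Kt}\right)P_\ell(\mu),\qquad G^c_N(t,\mu)=\sum_{\ell=0}^{N}\frac{2\ell+1}{4\pi}\left(e^{-\lambda_\ell t}-e^{-Kt}\right)P_\ell(\mu),$$ where the infinite series converges in $L^2([-1,1])$ for each $t$. For $t>0$ the normalized densities are $$p^c(t,\cdot)=\frac{G^c(t,\cdot)}{\|G^c(t,\cdot)\|_1},\qquad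 p^c_N(t,\cdot)=\frac{G^c_N(t,\cdot)}{\|G^c_N(t,\cdot)\|_1}.$$ At $t=0$, where $G^c$ and $G^c_N$ vanish, these are understood as their limits as $t\to0^+$, namely $p^c(0,\cdot)=B/\|B\|_1$ and $p^c_N(0,\cdot)=S_NB/\|S_NB\|_1$. *)

theory Defs
  imports
    "HOL-Probability.Essential_Supremum"
    "HOL-Computational_Algebra.Polynomial"
begin

section \<open>Norms on \<open>[-1,1]\<close>\<close>

abbreviation leb11 :: "real measure" where
  "leb11 \<equiv> lebesgue_on {-1..1}"

text \<open>
  Elements of \<open>L\<^sup>2([-1,1])\<close> are represented by functions \<open>real \<Rightarrow> real\<close>; only the values on
  \<open>[-1,1]\<close>, up to null sets, matter.
\<close>

definition in_L2 :: "(real \<Rightarrow> real) \<Rightarrow> bool" where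
  "in_L2 f \<longleftrightarrow> f \<in> borel_measurable leb11 \<and> integrable leb11 (\<lambda>x. (f x)\<^sup>2)"

definition L1_norm :: "(real \<Rightarrow> real) \<Rightarrow> real" where
  "L1_norm f = (LINT x|leb11. \<bar>f x\<bar>)"

definition L2_norm :: "(real \<Rightarrow> real) \<Rightarrow> real" where
  "L2_norm f = sqrt (LINT x|leb11. (f x)\<^sup>2)"

text \<open>
  Extended-real valued, so that an essentially unbounded function has norm \<open>\<infinity>\<close>.  The two norms
  above are real-valued (their Bochner integrals are \<open>0\<close> by convention if the integrand is not
  integrable) and are only meant for functions in \<open>L\<^sup>2([-1,1])\<close>.
\<close>

definition Linf_norm :: "(real \<Rightarrow> real) \<Rightarrow> ereal" where
  "Linf_norm f = esssup leb11 (\<lambda>x. ereal \<bar>f x\<bar>)"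


section \<open>Legendre polynomials\<close>

text \<open>Rodrigues' formula.\<close>

definition legendre_poly :: "nat \<Rightarrow> real poly" where
  "legendre_poly l = smult (1 / (2 ^ l * fact l)) ((pderiv ^^ l) ([:-1, 0, 1:] ^ l))"

definition legendre :: "nat \<Rightarrow> real \<Rightarrow> real" where
  "legendre l \<mu> = poly (legendre_poly l) \<mu>"

lemma degree_funpow_pderiv: "degree ((pderiv ^^ k) (p :: real poly)) = degree p - k"
  by (induction k) (auto simp: degree_pderiv)

lemma degree_legendre_poly: "degree (legendre_poly l) = l"
  by (simp add: legendre_poly_def degree_funpow_pderiv degree_power_eq)

lemma poly_funpow_pderiv_at_1:
  "poly ((pderiv ^^ n) ([:-1, 1:] ^ n * q)) 1 = fact n * poly (q :: real poly) 1"
proof (induction n arbitrary: q)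
  case (Suc n)
  have "pderiv ([:-1, 1:] ^ Suc n * q)
      = [:-1, 1:] ^ n * (smult (of_nat (Suc n)) q + [:-1, 1:] * pderiv q)"
    by (simp only: pderiv_mult pderiv_power_Suc) (simp add: algebra_simps pderiv_pCons)
  then have "poly ((pderiv ^^ Suc n) ([:-1, 1:] ^ Suc n * q)) 1
      = fact n * poly (smult (of_nat (Suc n)) q + [:-1, 1:] * pderiv q) 1"
    by (simp only: funpow_Suc_right o_def Suc.IH)
  then show ?case by (simp add: algebra_simps)
qed simp

lemma legendre_1: "legendre l 1 = 1"
proof -
  have "[:-1, 0, 1:] = [:-1, 1:] * [:1, 1 :: real:]" by simp
  then have "[:-1, 0, 1:] ^ l = [:-1, 1:] ^ l * [:1, 1 :: real:] ^ l"
    by (simp only: power_mult_distrib)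
  then show ?thesis
    by (simp add: legendre_def legendre_poly_def poly_funpow_pderiv_at_1)
qed


section \<open>Legendre expansion of the kernel\<close>

definition legendre_coeff :: "(real \<Rightarrow> real) \<Rightarrow> nat \<Rightarrow> real" where
  "legendre_coeff B l = (2 * real l + 1) / 2 * (LINT \<mu>|leb11. B \<mu> * legendre l \<mu>)"

definition legendre_proj :: "(real \<Rightarrow> real) \<Rightarrow> nat \<Rightarrow> real \<Rightarrow> real" where
  "legendre_proj B N \<mu> = (\<Sum>l\<le>N. legendre_coeff B l * legendre l \<mu>)"

definition lambda_coll :: "(real \<Rightarrow> real) \<Rightarrow> nat \<Rightarrow> real" where
  "lambda_coll B l = 2 * pi * (LINT \<mu>|leb11. B \<mu> * (1 - legendre l \<mu>))"

definition K_coll :: "(real \<Rightarrow> real) \<Rightarrow> real" where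
  "K_coll B = lim (lambda_coll B)"


section \<open>Continuous component of the Green's function and normalized densities\<close>

definition Gc_trunc :: "(real \<Rightarrow> real) \<Rightarrow> nat \<Rightarrow> real \<Rightarrow> real \<Rightarrow> real" where
  "Gc_trunc B N t \<mu> =
     (\<Sum>l\<le>N. (2 * real l + 1) / (4 * pi)
             * (exp (- lambda_coll B l * t) - exp (- K_coll B * t)) * legendre l \<mu>)"

text \<open>
  The infinite series is the \<open>L\<^sup>2\<close> limit of its partial sums; \<open>SOME\<close> picks a representative
  of this limit, which is unique up to null sets.
\<close>

definition Gc :: "(real \<Rightarrow> real) \<Rightarrow> real \<Rightarrow> real \<Rightarrow> real" where
  "Gc B t = (SOME g. in_L2 g \<and> (\<lambda>N. L2_norm (\<lambda>\<mu>. g \<mu> - Gc_trunc B N t \<mu>)) \<longlonglongrightarrow> 0)"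

text \<open>At \<open>t = 0\<close> the densities are given by their limits as \<open>t \<rightarrow> 0+\<close>.\<close>

definition pc :: "(real \<Rightarrow> real) \<Rightarrow> real \<Rightarrow> real \<Rightarrow> real" where
  "pc B t \<mu> = (if t = 0 then B \<mu> / L1_norm B else Gc B t \<mu> / L1_norm (Gc B t))"

definition pc_trunc :: "(real \<Rightarrow> real) \<Rightarrow> nat \<Rightarrow> real \<Rightarrow> real \<Rightarrow> real" where
  "pc_trunc B N t \<mu> =
     (if t = 0 then legendre_proj B N \<mu> / L1_norm (legendre_proj B N)
      else Gc_trunc B N t \<mu> / L1_norm (Gc_trunc B N t))"

end

theory Submission
  imports Defs
begin

text \<open>
  Write \<open>m l\<close> for the moment \<open>\<integral> B P\<^sub>l\<close>, so that \<open>B\<^sub>l = (2l+1)/2 \<cdot> m l\<close>, \<open>\<lambda>\<^sub>l = 2\<pi> (m 0 - m l)\<close> and,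
  since the moments tend to \<open>0\<close> by Bessel's inequality, \<open>K = 2\<pi> \<cdot> m 0\<close>.  Then
  \<open>exp (- \<lambda>\<^sub>l t) - exp (- K t) = exp (- K t) (exp x\<^sub>l - 1)\<close> with \<open>x\<^sub>l = 2\<pi> t \<cdot> m l\<close>.

  \<^bold>\<open>Convergence.\<close>  Splitting \<open>exp x\<^sub>l - 1 = x\<^sub>l + (exp x\<^sub>l - 1 - x\<^sub>l)\<close> turns the series for \<open>G\<^sup>c\<close> into
  \<open>exp (- K t) t B\<close> plus a remainder.  As \<open>B \<ge> 0\<close> and \<open>\<bar>P\<^sub>l\<bar> \<le> 1\<close> give \<open>\<bar>x\<^sub>l\<bar> \<le> K t\<close>, the damping
  factor \<open>exp (- K t)\<close> absorbs the exponential growth in Taylor's formula, and the coefficients of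
  the remainder are at most \<open>\<pi> t\<^sup>2 (2l+1)/2 (m l)\<^sup>2\<close>; these are \<open>\<pi> t\<^sup>2\<close> times the summands in
  Parseval's identity for \<open>B\<close>.  So the remainder converges uniformly, with a tail of at most
  \<open>\<pi> t\<^sup>2 \<parallel>B - S\<^sub>N B\<parallel>\<^sub>2\<^sup>2\<close>, which is the quantitative bound.  The leading term converges in \<open>L\<^sup>2\<close> by
  completeness of the Legendre polynomials.  Convergence of the normalized densities
  follows, because \<open>L\<^sup>2\<close> convergence on \<open>[-1,1]\<close> implies \<open>L\<^sup>1\<close> convergence and the limits have positive
  \<open>L\<^sup>1\<close> norm; for \<open>t > 0\<close> this holds because \<open>\<integral> G\<^sup>c = (1 - exp (- K t)) / (2\<pi>)\<close>.

  \<^bold>\<open>Positivity.\<close>  Expanding \<open>exp x\<^sub>l - 1\<close> fully, \<open>exp (K t) G\<^sup>c\<close> is a series in \<open>t\<close> whose \<open>k\<close>-th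
  coefficient is a positive multiple of the function with Legendre coefficients
  \<open>(2l+1)/2 (m l)^k\<close>, that is, of the \<open>k\<close>-fold convolution power of \<open>B\<close> on the sphere.  Two facts
  about these powers suffice.
  \<^item> Each is nonnegative: multiplying Legendre coefficients by \<open>m l\<close> averages translates of a function
    against \<open>B\<close>, and translation on the sphere preserves lower bounds by the product formula
    \<open>P\<^sub>l(x) P\<^sub>l(y) = 1/\<pi> \<integral>\<^sub>0\<^sup>\<pi> P\<^sub>l(x y + \<surd>(1-x\<^sup>2) \<surd>(1-y\<^sup>2) cos \<phi>) d\<phi>\<close>.
  \<^item> One of them has a positive lower bound: since \<open>\<bar>P\<^sub>l\<bar> < 1\<close> almost everywhere for \<open>l \<ge> 1\<close>, there is
    \<open>\<rho> < 1\<close> with \<open>\<bar>m l\<bar> \<le> \<rho> \<cdot> m 0\<close> for all \<open>l \<ge> 1\<close>, so for large \<open>k\<close> the constant term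
    \<open>(m 0)^k / 2\<close> dominates all others together.

  The argument uses only the truncations of these powers, where nonnegativity holds up to an
  arbitrarily small error once the truncation order is large; uniform convergence of \<open>S\<^sub>N B\<close> starts this
  induction on \<open>k\<close>.

  The product formula itself comes from Legendre's equation.  In the variable \<open>\<theta> = arccos x\<close> the
  averaged right-hand side satisfies the same singular equation as \<open>P\<^sub>l(cos \<theta>)\<close>, and an energy estimate
  shows that a solution with vanishing initial data at \<open>\<theta> = 0\<close> vanishes on \<open>[0,\<pi>]\<close>.  The formula also
  yields \<open>\<bar>P\<^sub>l\<bar> \<le> 1\<close> and \<open>P\<^sub>l(-1)\<^sup>2 = 1\<close> at once.
\<close>

section \<open>Legendre's differential equation and the product formula\<close>

lemma funpow_pderiv_X_mult:
  "(pderiv ^^ n) ([:0, 1:] * q) =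
     [:0, 1:] * (pderiv ^^ n) q + smult (of_nat n) ((pderiv ^^ (n - 1)) (q :: real poly))"
proof (induction n)
  case (Suc n)
  have "smult (of_nat n) (pderiv ((pderiv ^^ (n - 1)) q)) = smult (of_nat n) ((pderiv ^^ n) q)"
    by (cases n) auto
  moreover have "pderiv [:0, 1::real:] = 1" by (simp add: pderiv_pCons)
  moreover have "(pderiv ^^ Suc n) ([:0, 1:] * q) = pderiv ([:0, 1:] * (pderiv ^^ n) q
      + smult (of_nat n) ((pderiv ^^ (n - 1)) q))"
    by (simp only: funpow.simps o_def Suc.IH)
  ultimately show ?case
    by (simp add: pderiv_add pderiv_mult pderiv_smult algebra_simps smult_add_left
        del: mult_pCons_left mult_pCons_right)
qed simp

text \<open>
The polynomial \<open>u = (x\<^sup>2 - 1)^l\<close> satisfies \<open>(x\<^sup>2 - 1) u' = 2 l x u\<close>. Differentiating this \<open>l + 1\<close> times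
gives Legendre's equation for the \<open>l\<close>-th derivative of \<open>u\<close>, which is \<open>P\<^sub>l\<close> up to a constant.
\<close>

lemma legendre_poly_ode:
  "poly (pderiv (pderiv (legendre_poly l))) x * (1 - x\<^sup>2) =
     2 * x * poly (pderiv (legendre_poly l)) x - real (l * (l + 1)) * poly (legendre_poly l) x"
proof -
  let ?X = "[:0, 1 :: real:]"
  define u where "u = [:-1, 0, 1 :: real:] ^ l"
  define v where "v = (pderiv ^^ l) u"
  have D: "(pderiv ^^ n) (pderiv q) = (pderiv ^^ Suc n) q" for n and q :: "real poly"
    by (simp add: funpow_swap1)
  have q: "[:-1, 0, 1:] = ?X * ?X - 1" by (simp add: one_pCons)
  have "[:-1, 0, 1:] * pderiv u = smult (2 * real l) (?X * u)"
  proof (cases l)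
    case (Suc k)
    define a where "a = 2 * real l"
    have "[:0, 2:] = smult 2 ?X" by simp
    then have "pderiv u = smult a ([:-1, 0, 1:] ^ k * ?X)"
      unfolding u_def Suc pderiv_power_Suc a_def by (simp add: pderiv_pCons)
    then have "[:-1, 0, 1:] * pderiv u = smult a (?X * u)"
      unfolding u_def Suc power_Suc by (simp only: mult_smult_right ac_simps)
    then show ?thesis unfolding a_def .
  qed (simp add: u_def pderiv_1)
  then have "?X * (?X * pderiv u) - pderiv u = smult (2 * real l) (?X * u)"
    unfolding q by (simp only: algebra_simps mult_1_right mult_1_left)
  then have "(pderiv ^^ Suc l) (?X * (?X * pderiv u) - pderiv u)
      = (pderiv ^^ Suc l) (smult (2 * real l) (?X * u))" by simp
  moreover have "(pderiv ^^ n) (p - q) = (pderiv ^^ n) p - (pderiv ^^ n) q" for n and p q :: "real poly"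
    by (induction n) (auto simp: pderiv_diff)
  moreover have "(pderiv ^^ n) (smult a p) = smult a ((pderiv ^^ n) p)" for n a and p :: "real poly"
    by (induction n) (auto simp: pderiv_smult)
  ultimately have "(pderiv ^^ Suc l) (?X * (?X * pderiv u)) - (pderiv ^^ Suc l) (pderiv u)
      = smult (2 * real l) ((pderiv ^^ Suc l) (?X * u))" by metis
  moreover have "smult (real l) ((pderiv ^^ (l - 1)) (pderiv u)) = smult (real l) v"
    by (cases l) (auto simp: v_def D simp del: funpow.simps)
  ultimately have "poly (?X * (?X * pderiv (pderiv v) + smult (real (Suc l)) (pderiv v))
     + smult (real (Suc l)) (?X * pderiv v + smult (real l) v) - pderiv (pderiv v)) x
     = poly (smult (2 * real l) (?X * pderiv v + smult (real (Suc l)) v)) x"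
    by (simp only: funpow_pderiv_X_mult D) (simp add: v_def del: mult_pCons_left smult_add_right)
  then have "poly (pderiv (pderiv v)) x * (1 - x\<^sup>2) = 2 * x * poly (pderiv v) x - real (l * (l + 1)) * poly v x"
    by (simp add: algebra_simps power2_eq_square)
  moreover have "legendre_poly l = smult (1 / (2 ^ l * fact l)) v"
    by (simp add: legendre_poly_def u_def v_def)
  ultimately show ?thesis
    by (simp add: pderiv_smult field_simps)
qed

text \<open>
The energy \<open>E = c D\<^sup>2 + D'\<^sup>2\<close> has derivative \<open>-2 cot \<theta> D'\<^sup>2\<close>, so it decreases on \<open>[0,\<pi>/2]\<close>. Beyond
\<open>\<pi>/2\<close> the sign changes, but \<open>E sin\<^sup>2 \<theta>\<close> has derivative \<open>2 c sin \<theta> cos \<theta> D\<^sup>2 \<le> 0\<close> there. Zero initial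
energy therefore stays zero. The equation is multiplied by \<open>sin\<^sup>2 \<theta>\<close> so that it makes sense at the
singular end points \<open>0\<close> and \<open>\<pi>\<close>.
\<close>

lemma legendre_ode_unique:
  fixes D :: "real \<Rightarrow> real"
  assumes D: "\<And>\<theta>. (D has_real_derivative D' \<theta>) (at \<theta>)"
    and D': "\<And>\<theta>. (D' has_real_derivative D'' \<theta>) (at \<theta>)"
    and ode: "\<And>\<theta>. (sin \<theta>)\<^sup>2 * D'' \<theta> + sin \<theta> * cos \<theta> * D' \<theta> + c * (sin \<theta>)\<^sup>2 * D \<theta> = 0"
    and c: "c \<ge> 0" and init: "D 0 = 0" "D' 0 = 0" and \<theta>: "\<theta> \<in> {0..pi}"
  shows "D \<theta> = 0"
proof -
  define E where "E \<theta> = c * (D \<theta>)\<^sup>2 + (D' \<theta>)\<^sup>2" for \<theta>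
  have ode': "sin x * D'' x = - cos x * D' x - c * sin x * D x" if "sin x \<noteq> 0" for x
  proof -
    have "sin x * (sin x * D'' x + cos x * D' x + c * sin x * D x) = 0"
      using ode[of x] by (simp add: algebra_simps power2_eq_square)
    with that have "sin x * D'' x + cos x * D' x + c * sin x * D x = 0" by simp
    then show ?thesis by linarith
  qed
  have dE: "(E has_real_derivative 2 * c * D x * D' x + 2 * D' x * D'' x) (at x)" for x
    unfolding E_def by (auto intro!: derivative_eq_intros D D')
  have E1: "E x = 0" if "x \<in> {0..pi/2}" for x
  proof -
    have "E x \<le> E 0"
    proof (rule DERIV_nonpos_imp_decreasing_open[of 0 x])
      fix y assume y: "0 < y" "y < x"
      then have s: "sin y > 0" "cos y \<ge> 0" using that by (auto intro!: sin_gt_zero cos_ge_zero)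
      have "sin y * (2 * c * D y * D' y + 2 * D' y * D'' y) = 2 * D' y * (sin y * D'' y + c * sin y * D y)"
        by (simp add: algebra_simps)
      also have "\<dots> = - 2 * cos y * (D' y)\<^sup>2"
        using ode'[of y] s by (simp add: algebra_simps power2_eq_square)
      also have "\<dots> \<le> 0" using s by simp
      finally have "2 * c * D y * D' y + 2 * D' y * D'' y \<le> 0"
        using s by (simp add: mult_le_0_iff)
      with dE show "\<exists>d. (E has_real_derivative d) (at y) \<and> d \<le> 0" by blast
    qed (use that DERIV_continuous_on[OF has_field_derivative_at_within[OF dE]] in auto)
    moreover have "E x \<ge> 0" "E 0 = 0" using c init by (auto simp: E_def)
    ultimately show ?thesis by simp
  qed
  have E2: "E x = 0" if "x \<in> {pi/2..<pi}" for x
  proof -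
    define F where "F x = E x * (sin x)\<^sup>2" for x
    have dF: "(F has_real_derivative (2 * c * D x * D' x + 2 * D' x * D'' x) * (sin x)\<^sup>2
        + 2 * sin x * cos x * E x) (at x)" for x
      unfolding F_def by (auto intro!: derivative_eq_intros dE)
    have "F x \<le> F (pi/2)"
    proof (rule DERIV_nonpos_imp_decreasing_open[of "pi/2" x])
      fix y assume y: "pi/2 < y" "y < x"
      then have s: "sin y > 0" "cos y \<le> 0" using that cos_gt_zero_pi[of "pi - y"]
        by (auto intro!: sin_gt_zero simp: cos_diff)
      have "(2 * c * D y * D' y + 2 * D' y * D'' y) * (sin y)\<^sup>2 + 2 * sin y * cos y * E y
         = 2 * D' y * sin y * (c * sin y * D y + sin y * D'' y) + 2 * sin y * cos y * E y"
        by (simp add: algebra_simps power2_eq_square)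
      also have "\<dots> = 2 * c * (D y)\<^sup>2 * sin y * cos y"
        using ode'[of y] s by (simp add: E_def algebra_simps power2_eq_square)
      also have "\<dots> \<le> 0" using s c by (simp add: mult_nonneg_nonpos)
      finally show "\<exists>d. (F has_real_derivative d) (at y) \<and> d \<le> 0" using dF by blast
    qed (use that DERIV_continuous_on[OF has_field_derivative_at_within[OF dF]] in auto)
    also have "F (pi/2) = 0" by (simp add: F_def E1)
    finally have "E x * (sin x)\<^sup>2 \<le> 0" by (simp add: F_def)
    moreover have "sin x > 0" using that pi_gt_zero by (intro sin_gt_zero) (auto simp del: pi_gt_zero)
    moreover have "E x \<ge> 0" using c by (simp add: E_def)
    ultimately show ?thesis by (simp add: mult_le_0_iff)
  qed
  have D'0: "D' x = 0" if "x \<in> {0..<pi}" for x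
  proof -
    have "E x = 0" using E1 E2 that by (cases "x \<le> pi/2") auto
    moreover have "c * (D x)\<^sup>2 \<ge> 0" using c by simp
    ultimately have "(D' x)\<^sup>2 \<le> 0" unfolding E_def by linarith
    then show ?thesis by simp
  qed
  have "D \<theta> = D 0"
  proof (cases "\<theta> = 0")
    case False
    show ?thesis
    proof (rule DERIV_isconst_end[where f=D and a=0 and b=\<theta>])
      show "0 < \<theta>" using \<theta> False by simp
      show "continuous_on {0..\<theta>} D"
        by (rule DERIV_continuous_on[OF has_field_derivative_at_within[OF D]])
      show "(D has_real_derivative 0) (at x)" if "0 < x" "x < \<theta>" for x
        using D[of x] D'0[of x] that \<theta> by simp
    qed
  qed simp
  with init show ?thesis by simp
qed

text \<open>
With \<open>z = cos \<theta> y + sin \<theta> \<surd>(1-y\<^sup>2) cos \<phi>\<close> (the spherical law of cosines), \<open>(\<theta>, \<phi>)\<close> are polar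
coordinates of a point on the sphere and \<open>z\<close> is the cosine of its distance to a fixed point. So
applying the spherical Laplacian to \<open>P\<^sub>l(z)\<close> multiplies it by \<open>-l(l+1)\<close>. Integration over \<open>\<phi>\<close> removes
the part of the Laplacian containing \<open>\<partial>\<^sup>2/\<partial>\<phi>\<^sup>2\<close>, whose primitive vanishes at \<open>\<phi> = 0\<close> and \<open>\<phi> = \<pi>\<close>.
What is left is Legendre's equation in \<open>\<theta>\<close>, which determines the integral from its value at
\<open>\<theta> = 0\<close>.
\<close>

lemma legendre_product_theta:
  assumes y: "y \<in> {-1..1}" and \<theta>: "\<theta> \<in> {0..pi}"
  shows "integral {0..pi} (\<lambda>\<phi>. legendre l (cos \<theta> * y + sin \<theta> * (sqrt (1 - y\<^sup>2) * cos \<phi>)))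
      = pi * (legendre l (cos \<theta>) * legendre l y)"
proof -
  define s where "s = sqrt (1 - y\<^sup>2)"
  have s2: "s\<^sup>2 = 1 - y\<^sup>2" using y by (simp add: s_def abs_square_le_1 abs_le_iff)
  define z where "z \<theta> \<phi> = cos \<theta> * y + sin \<theta> * (s * cos \<phi>)" for \<theta> \<phi>
  define z1 where "z1 \<theta> \<phi> = - sin \<theta> * y + cos \<theta> * (s * cos \<phi>)" for \<theta> \<phi>
  define p where "p = legendre_poly l"
  define c where "c = real (l * (l + 1))"
  have zd: "((\<lambda>\<theta>. z \<theta> \<phi>) has_real_derivative z1 \<theta> \<phi>) (at \<theta> within S)" for \<theta> \<phi> S
    unfolding z_def z1_def by (auto intro!: derivative_eq_intros)
  have z1d: "((\<lambda>\<theta>. z1 \<theta> \<phi>) has_real_derivative - z \<theta> \<phi>) (at \<theta> within S)" for \<theta> \<phi> S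
    unfolding z_def z1_def by (auto intro!: derivative_eq_intros)
  define V where "V \<theta> = integral (cbox 0 pi) (\<lambda>\<phi>. poly p (z \<theta> \<phi>))" for \<theta>
  define V1 where "V1 \<theta> = integral (cbox 0 pi) (\<lambda>\<phi>. poly (pderiv p) (z \<theta> \<phi>) * z1 \<theta> \<phi>)" for \<theta>
  define g2 where "g2 \<theta> \<phi> = poly (pderiv (pderiv p)) (z \<theta> \<phi>) * (z1 \<theta> \<phi>)\<^sup>2
       - poly (pderiv p) (z \<theta> \<phi>) * z \<theta> \<phi>" for \<theta> \<phi>
  define V2 where "V2 \<theta> = integral (cbox 0 pi) (g2 \<theta>)" for \<theta>
  have dV: "(V has_real_derivative V1 \<theta>) (at \<theta>)" for \<theta>
    unfolding V_def V1_def
  proof (rule leibniz_rule_field_derivative[where U=UNIV])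
    show "((\<lambda>x. poly p (z x t)) has_real_derivative poly (pderiv p) (z x t) * z1 x t) (at x within UNIV)" for x t
      using DERIV_chain2[OF poly_DERIV zd] .
  qed (auto intro!: integrable_continuous_interval continuous_intros simp: z_def z1_def case_prod_beta)
  have dV1: "(V1 has_real_derivative V2 \<theta>) (at \<theta>)" for \<theta>
    unfolding V1_def V2_def
  proof (rule leibniz_rule_field_derivative[where U=UNIV])
    show "((\<lambda>x. poly (pderiv p) (z x t) * z1 x t) has_real_derivative g2 x t) (at x within UNIV)" for x t
      by (rule DERIV_cong[OF DERIV_mult[OF DERIV_chain2[OF poly_DERIV zd] z1d]])
        (simp add: g2_def power2_eq_square algebra_simps)
  qed (auto intro!: integrable_continuous_interval continuous_intros simp: z_def z1_def g2_def case_prod_beta)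
  have odeV: "(sin \<theta>)\<^sup>2 * V2 \<theta> + sin \<theta> * cos \<theta> * V1 \<theta> + c * (sin \<theta>)\<^sup>2 * V \<theta> = 0" for \<theta>
  proof -
    \<comment> \<open>\<open>w = \<partial>z/\<partial>\<phi>\<close>, and \<open>h\<close> is the primitive of the \<open>\<phi>\<close>-part of the Laplacian.\<close>
    define w where "w \<phi> = - sin \<theta> * s * sin \<phi>" for \<phi>
    define h where "h \<phi> = poly (pderiv p) (z \<theta> \<phi>) * w \<phi>" for \<phi>
    define h1 where "h1 \<phi> = poly (pderiv (pderiv p)) (z \<theta> \<phi>) * (w \<phi>)\<^sup>2
          + poly (pderiv p) (z \<theta> \<phi>) * (- sin \<theta> * s * cos \<phi>)" for \<phi>
    have dz: "(z \<theta> has_real_derivative w \<phi>) (at \<phi> within S)" for \<phi> S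
      unfolding z_def w_def by (auto intro!: derivative_eq_intros)
    have dw: "(w has_real_derivative - sin \<theta> * s * cos \<phi>) (at \<phi> within S)" for \<phi> S
      unfolding w_def by (auto intro!: derivative_eq_intros)
    have "(h has_real_derivative h1 \<phi>) (at \<phi> within S)" for \<phi> S
      unfolding h_def
      by (rule DERIV_cong[OF DERIV_mult[OF DERIV_chain2[OF poly_DERIV dz] dw]])
        (simp add: h1_def power2_eq_square algebra_simps)
    then have hint: "(h1 has_integral h pi - h 0) {0..pi}"
      by (intro fundamental_theorem_of_calculus) (auto simp: has_real_derivative_iff_has_vector_derivative)
    \<comment> \<open>The eigenvalue equation of the spherical Laplacian, multiplied by \<open>sin\<^sup>2 \<theta>\<close>.\<close>
    have pt: "(sin \<theta>)\<^sup>2 * g2 \<theta> \<phi> + sin \<theta> * cos \<theta> * (poly (pderiv p) (z \<theta> \<phi>) * z1 \<theta> \<phi>)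
        + c * (sin \<theta>)\<^sup>2 * poly p (z \<theta> \<phi>) = - h1 \<phi>" for \<phi>
    proof -
      define S C k x P P1 P2 where abbrs: "S = sin \<theta>" "C = cos \<theta>" "k = s * cos \<phi>"
        "x = z \<theta> \<phi>" "P = poly p x" "P1 = poly (pderiv p) x" "P2 = poly (pderiv (pderiv p)) x"
      have C2: "C\<^sup>2 = 1 - S\<^sup>2" by (simp add: abbrs cos_squared_eq)
      have w2: "(w \<phi>)\<^sup>2 = S\<^sup>2 * (1 - y\<^sup>2 - k\<^sup>2)"
        by (simp add: w_def abbrs power_mult_distrib sin_squared_eq s2 algebra_simps)
      have x: "x = C * y + S * k" by (simp add: abbrs z_def)
      have z1: "z1 \<theta> \<phi> = - S * y + C * k" by (simp add: abbrs z1_def)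
      have ode: "P2 * (1 - x\<^sup>2) = 2 * x * P1 - c * P"
        using legendre_poly_ode[of l x] by (simp add: abbrs p_def c_def)
      have a: "(z1 \<theta> \<phi>)\<^sup>2 + x\<^sup>2 = (C\<^sup>2 + S\<^sup>2) * (y\<^sup>2 + k\<^sup>2)"
        by (simp only: z1 x) (simp add: power2_eq_square algebra_simps)
      have a': "S\<^sup>2 * (z1 \<theta> \<phi>)\<^sup>2 + (w \<phi>)\<^sup>2 = S\<^sup>2 * (1 - x\<^sup>2)"
      proof -
        have "(z1 \<theta> \<phi>)\<^sup>2 = y\<^sup>2 + k\<^sup>2 - x\<^sup>2" using a C2 by simp
        then show ?thesis unfolding w2 by (simp only:) (simp add: algebra_simps)
      qed
      have b: "S * C * z1 \<theta> \<phi> - S\<^sup>2 * x - S * k = - 2 * S\<^sup>2 * x"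
      proof -
        have "S * C * z1 \<theta> \<phi> + S\<^sup>2 * x = S * k * (C\<^sup>2 + S\<^sup>2)"
          by (simp only: z1 x) (simp add: power2_eq_square algebra_simps)
        then have "S * C * z1 \<theta> \<phi> + S\<^sup>2 * x = S * k" using C2 by simp
        then show ?thesis by linarith
      qed
      have "S\<^sup>2 * (P2 * (z1 \<theta> \<phi>)\<^sup>2 - P1 * x) + S * C * (P1 * z1 \<theta> \<phi>) + c * S\<^sup>2 * P
           + (P2 * (w \<phi>)\<^sup>2 + P1 * (- S * k))
         = P2 * (S\<^sup>2 * (z1 \<theta> \<phi>)\<^sup>2 + (w \<phi>)\<^sup>2) + P1 * (S * C * z1 \<theta> \<phi> - S\<^sup>2 * x - S * k) + c * S\<^sup>2 * P"
        by (simp add: algebra_simps)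
      also have "\<dots> = S\<^sup>2 * (P2 * (1 - x\<^sup>2)) - 2 * S\<^sup>2 * x * P1 + c * S\<^sup>2 * P"
        unfolding a' b by (simp add: algebra_simps)
      also have "\<dots> = 0" unfolding ode by (simp add: algebra_simps)
      finally show ?thesis
        by (simp add: g2_def h1_def abbrs algebra_simps)
    qed
    have "integral {0..pi} (\<lambda>\<phi>. - h1 \<phi>) = 0"
      using integral_unique[OF hint] by (simp add: h_def w_def)
    moreover have "g2 \<theta> integrable_on {0..pi}"
      "(\<lambda>\<phi>. poly (pderiv p) (z \<theta> \<phi>) * z1 \<theta> \<phi>) integrable_on {0..pi}"
      "(\<lambda>\<phi>. poly p (z \<theta> \<phi>)) integrable_on {0..pi}"
      unfolding g2_def z_def z1_def by (intro integrable_continuous_interval continuous_intros)+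
    then have "((\<lambda>\<phi>. (sin \<theta>)\<^sup>2 * g2 \<theta> \<phi>
        + sin \<theta> * cos \<theta> * (poly (pderiv p) (z \<theta> \<phi>) * z1 \<theta> \<phi>)
        + c * (sin \<theta>)\<^sup>2 * poly p (z \<theta> \<phi>))
      has_integral (sin \<theta>)\<^sup>2 * V2 \<theta> + sin \<theta> * cos \<theta> * V1 \<theta> + c * (sin \<theta>)\<^sup>2 * V \<theta>) {0..pi}"
      unfolding V_def V1_def V2_def cbox_interval
      by (intro has_integral_add has_integral_mult_right integrable_integral)
    then have "((\<lambda>\<phi>. - h1 \<phi>)
      has_integral (sin \<theta>)\<^sup>2 * V2 \<theta> + sin \<theta> * cos \<theta> * V1 \<theta> + c * (sin \<theta>)\<^sup>2 * V \<theta>) {0..pi}"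
      unfolding pt .
    ultimately show ?thesis using integral_unique by metis
  qed
  define Q where "Q \<theta> = poly p (cos \<theta>)" for \<theta>
  define Q1 where "Q1 \<theta> = poly (pderiv p) (cos \<theta>) * (- sin \<theta>)" for \<theta>
  define Q2 where "Q2 \<theta> = poly (pderiv (pderiv p)) (cos \<theta>) * (sin \<theta>)\<^sup>2 - poly (pderiv p) (cos \<theta>) * cos \<theta>" for \<theta>
  have dQ: "(Q has_real_derivative Q1 \<theta>) (at \<theta>)" for \<theta>
    unfolding Q_def Q1_def by (intro DERIV_chain2[OF poly_DERIV] DERIV_cos)
  have dQ1: "(Q1 has_real_derivative Q2 \<theta>) (at \<theta>)" for \<theta>
    unfolding Q1_def
    by (rule DERIV_cong[OF DERIV_mult[OF DERIV_chain2[OF poly_DERIV DERIV_cos] DERIV_minus[OF DERIV_sin]]])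
      (simp add: Q2_def power2_eq_square algebra_simps)
  have odeQ: "(sin \<theta>)\<^sup>2 * Q2 \<theta> + sin \<theta> * cos \<theta> * Q1 \<theta> + c * (sin \<theta>)\<^sup>2 * Q \<theta> = 0" for \<theta>
  proof -
    have "(sin \<theta>)\<^sup>2 * Q2 \<theta> + sin \<theta> * cos \<theta> * Q1 \<theta> + c * (sin \<theta>)\<^sup>2 * Q \<theta>
      = (sin \<theta>)\<^sup>2 * (poly (pderiv (pderiv p)) (cos \<theta>) * (1 - (cos \<theta>)\<^sup>2)
          - 2 * cos \<theta> * poly (pderiv p) (cos \<theta>) + c * poly p (cos \<theta>))"
      unfolding sin_squared_eq[symmetric]
      by (simp add: Q_def Q1_def Q2_def algebra_simps power2_eq_square)
    then show ?thesis using legendre_poly_ode[of l "cos \<theta>"] by (simp add: p_def c_def)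
  qed
  define a where "a = pi * poly p y"
  have "V \<theta> - a * Q \<theta> = 0"
  proof (rule legendre_ode_unique[where \<theta>=\<theta> and D="\<lambda>\<theta>. V \<theta> - a * Q \<theta>" and D'="\<lambda>\<theta>. V1 \<theta> - a * Q1 \<theta>" and D''="\<lambda>\<theta>. V2 \<theta> - a * Q2 \<theta>" and c=c])
    show "(sin \<theta>)\<^sup>2 * (V2 \<theta> - a * Q2 \<theta>) + sin \<theta> * cos \<theta> * (V1 \<theta> - a * Q1 \<theta>) + c * (sin \<theta>)\<^sup>2 * (V \<theta> - a * Q \<theta>) = 0" for \<theta>
    proof -
      have "(sin \<theta>)\<^sup>2 * (V2 \<theta> - a * Q2 \<theta>) + sin \<theta> * cos \<theta> * (V1 \<theta> - a * Q1 \<theta>) + c * (sin \<theta>)\<^sup>2 * (V \<theta> - a * Q \<theta>)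
        = ((sin \<theta>)\<^sup>2 * V2 \<theta> + sin \<theta> * cos \<theta> * V1 \<theta> + c * (sin \<theta>)\<^sup>2 * V \<theta>)
          - a * ((sin \<theta>)\<^sup>2 * Q2 \<theta> + sin \<theta> * cos \<theta> * Q1 \<theta> + c * (sin \<theta>)\<^sup>2 * Q \<theta>)"
        by (simp add: algebra_simps)
      then show ?thesis by (simp add: odeV odeQ)
    qed
    have "legendre l 1 = 1" by (rule legendre_1)
    then show "V 0 - a * Q 0 = 0"
      by (simp add: V_def Q_def a_def z_def p_def legendre_def)
    have "((\<lambda>\<phi>. poly (pderiv p) y * (s * cos \<phi>)) has_integral
        poly (pderiv p) y * (s * sin pi) - poly (pderiv p) y * (s * sin 0)) {0..pi}"
      by (intro fundamental_theorem_of_calculus)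
        (auto simp: has_real_derivative_iff_has_vector_derivative[symmetric] intro!: derivative_eq_intros)
    then have "V1 0 = 0"
      by (simp add: V1_def z_def z1_def integral_unique)
    then show "V1 0 - a * Q1 0 = 0" by (simp add: Q1_def)
    show "((\<lambda>\<theta>. V \<theta> - a * Q \<theta>) has_real_derivative V1 \<theta> - a * Q1 \<theta>) (at \<theta>)" for \<theta>
      by (intro DERIV_diff DERIV_cmult dV dQ)
    show "((\<lambda>\<theta>. V1 \<theta> - a * Q1 \<theta>) has_real_derivative V2 \<theta> - a * Q2 \<theta>) (at \<theta>)" for \<theta>
      by (intro DERIV_diff DERIV_cmult dV1 dQ1)
  qed (use \<theta> in \<open>simp_all add: c_def\<close>)
  then show ?thesis
    by (simp add: V_def Q_def a_def p_def z_def s_def legendre_def)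
qed

lemma continuous_on_legendre [continuous_intros]:
  "continuous_on S f \<Longrightarrow> continuous_on S (\<lambda>x. legendre l (f x))"
  unfolding legendre_def by (intro continuous_intros)

lemma spherical_cosine_law_bounds:
  assumes "x \<in> {-1..1}" "y \<in> {-1..1}"
  shows "x * y + sqrt (1 - x\<^sup>2) * sqrt (1 - y\<^sup>2) * cos \<phi> \<in> {-1..1}"
proof -
  have x2: "x\<^sup>2 \<le> 1" and y2: "y\<^sup>2 \<le> 1" using assms by (auto simp: abs_square_le_1 abs_le_iff)
  have "\<bar>x * y + sqrt (1 - x\<^sup>2) * sqrt (1 - y\<^sup>2) * cos \<phi>\<bar>
     \<le> \<bar>x * y\<bar> + \<bar>sqrt (1 - x\<^sup>2) * sqrt (1 - y\<^sup>2)\<bar> * \<bar>cos \<phi>\<bar>"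
    by (simp add: abs_mult[symmetric] abs_triangle_ineq)
  also have "\<dots> \<le> \<bar>x * y\<bar> + \<bar>sqrt (1 - x\<^sup>2) * sqrt (1 - y\<^sup>2)\<bar> * 1"
    by (intro add_mono mult_left_mono) auto
  also have "\<dots> \<le> (x\<^sup>2 + y\<^sup>2) / 2 + ((1 - x\<^sup>2) + (1 - y\<^sup>2)) / 2"
  proof -
    have am: "\<bar>a * b\<bar> \<le> (a\<^sup>2 + b\<^sup>2) / 2" for a b :: real
    proof -
      have "0 \<le> (\<bar>a\<bar> - \<bar>b\<bar>)\<^sup>2" by simp
      also have "(\<bar>a\<bar> - \<bar>b\<bar>)\<^sup>2 = a\<^sup>2 + b\<^sup>2 - 2 * \<bar>a * b\<bar>"
        by (simp add: power2_diff abs_mult)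
      finally show ?thesis by simp
    qed
    show ?thesis
      using am[of x y] am[of "sqrt (1 - x\<^sup>2)" "sqrt (1 - y\<^sup>2)"] x2 y2
      by (simp add: field_simps)
  qed
  also have "\<dots> = 1" by (simp add: field_simps)
  finally show ?thesis by (auto simp: abs_le_iff)
qed

text \<open>
Legendre polynomials are the zonal spherical functions: averaging \<open>P\<^sub>l\<close> over a circle on the sphere
gives a product of two values of \<open>P\<^sub>l\<close>.
\<close>

lemma legendre_product_formula:
  assumes "x \<in> {-1..1}" "y \<in> {-1..1}"
  shows "integral {0..pi} (\<lambda>\<phi>. legendre l (x * y + sqrt (1 - x\<^sup>2) * sqrt (1 - y\<^sup>2) * cos \<phi>))
      = pi * (legendre l x * legendre l y)"
  using legendre_product_theta[OF assms(2), of "arccos x" l] assms arccos_lbound[of x] arccos_ubound[of x]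
  by (simp add: sin_arccos cos_arccos mult.assoc)

text \<open>
If \<open>M\<close> is the maximum of \<open>\<bar>P\<^sub>l\<bar>\<close>, attained at \<open>m\<close>, the product formula at \<open>x = y = m\<close> writes \<open>M\<^sup>2\<close> as
the modulus of an average of values of \<open>P\<^sub>l\<close>, whence \<open>M\<^sup>2 \<le> M\<close>.
\<close>

lemma abs_legendre_le_1:
  assumes "x \<in> {-1..1}"
  shows "\<bar>legendre l x\<bar> \<le> 1"
proof -
  have "continuous_on {-1..1} (\<lambda>x. \<bar>legendre l x\<bar>)" by (intro continuous_intros)
  then obtain m where m: "m \<in> {-1..1}" "\<And>y. y \<in> {-1..1} \<Longrightarrow> \<bar>legendre l y\<bar> \<le> \<bar>legendre l m\<bar>"
    using continuous_attains_sup[of "{-1..1::real}" "\<lambda>x. \<bar>legendre l x\<bar>"] by (auto simp: Ball_def)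
  define M where "M = \<bar>legendre l m\<bar>"
  have "norm (integral {0..pi} (\<lambda>\<phi>. legendre l (m * m + sqrt (1 - m\<^sup>2) * sqrt (1 - m\<^sup>2) * cos \<phi>)))
      \<le> integral {0..pi} (\<lambda>_. M)"
    using m spherical_cosine_law_bounds[OF m(1) m(1)]
    by (intro integral_norm_bound_integral integrable_continuous_interval continuous_intros)
      (auto simp: M_def)
  then have "pi * (M * M) \<le> pi * M"
    unfolding legendre_product_formula[OF m(1) m(1)] by (simp add: M_def abs_mult mult.commute)
  then have "M * M \<le> M * 1" by simp
  then have "M \<le> 1" unfolding M_def mult_le_cancel_left by linarith
  with m(2)[OF assms] show ?thesis unfolding M_def by linarith
qed

text \<open>
For \<open>x = y = -1\<close> the integrand of the product formula is the constant \<open>P\<^sub>l(1)\<close>.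
\<close>

lemma legendre_minus_1_sq: "(legendre l (-1))\<^sup>2 = 1"
  using legendre_product_formula[of "-1" "-1" l]
  by (simp add: legendre_1 power2_eq_square)

text \<open>
The sum on the right is the average of \<open>f = \<Sum> a\<^sub>l P\<^sub>l\<close> over a circle on the sphere, by the product
formula; an average keeps every lower bound of \<open>f\<close>.
\<close>

lemma legendre_translate_lower_bound:
  assumes f: "\<And>z. z \<in> {-1..1} \<Longrightarrow> c \<le> (\<Sum>l\<le>N. a l * legendre l z)"
    and x: "x \<in> {-1..1}" and y: "y \<in> {-1..1}"
  shows "c \<le> (\<Sum>l\<le>N. a l * (legendre l x * legendre l y))"
proof -
  define z where "z \<phi> = x * y + sqrt (1 - x\<^sup>2) * sqrt (1 - y\<^sup>2) * cos \<phi>" for \<phi>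
  have zc: "continuous_on A z" for A unfolding z_def by (intro continuous_intros)
  have "pi * c = integral {0..pi} (\<lambda>_. c)" by simp
  also have "\<dots> \<le> integral {0..pi} (\<lambda>\<phi>. \<Sum>l\<le>N. a l * legendre l (z \<phi>))"
    using f spherical_cosine_law_bounds[OF x y]
    by (intro integral_le integrable_continuous_interval continuous_intros zc) (auto simp: z_def)
  also have "\<dots> = (\<Sum>l\<le>N. integral {0..pi} (\<lambda>\<phi>. a l * legendre l (z \<phi>)))"
    by (intro integral_sum integrable_continuous_interval continuous_intros zc) auto
  also have "\<dots> = (\<Sum>l\<le>N. pi * (a l * (legendre l x * legendre l y)))"
  proof (rule sum.cong[OF refl])
    fix l
    have "integral {0..pi} (\<lambda>\<phi>. a l * legendre l (z \<phi>)) = a l * integral {0..pi} (\<lambda>\<phi>. legendre l (z \<phi>))"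
      by (rule integral_mult_right)
    then show "integral {0..pi} (\<lambda>\<phi>. a l * legendre l (z \<phi>)) = pi * (a l * (legendre l x * legendre l y))"
      unfolding z_def legendre_product_formula[OF x y] by simp
  qed
  finally have "pi * c \<le> pi * (\<Sum>l\<le>N. a l * (legendre l x * legendre l y))"
    by (simp add: sum_distrib_left)
  then show ?thesis by simp
qed

section \<open>Integration and square-integrable functions on \<open>[-1,1]\<close>\<close>

lemma leb11_continuous:
  fixes f :: "real \<Rightarrow> real"
  assumes "continuous_on {-1..1} f"
  shows "f \<in> borel_measurable leb11" "integrable leb11 f" "integral\<^sup>L leb11 f = integral {-1..1} f"
  using assms continuous_imp_integrable_real[OF assms]
  by (auto simp: lebesgue_integral_eq_integral continuous_imp_measurable_on_sets_lebesgue)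

lemma leb11_FTC:
  fixes F f :: "real \<Rightarrow> real"
  assumes "\<And>x. (F has_real_derivative f x) (at x)" "continuous_on {-1..1} f"
  shows "integral\<^sup>L leb11 f = F 1 - F (-1)"
proof -
  have "(f has_integral F 1 - F (-1)) {-1..1}"
    using assms(1) by (intro fundamental_theorem_of_calculus)
      (auto simp: has_real_derivative_iff_has_vector_derivative intro: has_vector_derivative_at_within)
  then show ?thesis using leb11_continuous[OF assms(2)] by (simp add: integral_unique)
qed

lemma finite_measure_leb11: "finite_measure leb11"
  by (rule finite_measureI) (simp add: emeasure_restrict_space)

lemma in_L2_continuous:
  assumes "continuous_on {-1..1} f"
  shows "in_L2 f"
  unfolding in_L2_def using assms by (auto intro!: leb11_continuous continuous_intros)

lemma in_L2_measurable: "in_L2 f \<Longrightarrow> f \<in> borel_measurable leb11"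
  by (simp add: in_L2_def)

lemma in_L2_mult_integrable:
  assumes "in_L2 f" "in_L2 g"
  shows "integrable leb11 (\<lambda>x. f x * g x)"
proof (rule Bochner_Integration.integrable_bound)
  show "integrable leb11 (\<lambda>x. (f x)\<^sup>2 + (g x)\<^sup>2)"
    using assms by (auto simp: in_L2_def)
  show "AE x in leb11. norm (f x * g x) \<le> norm ((f x)\<^sup>2 + (g x)\<^sup>2)"
  proof (intro AE_I2)
    fix x
    have "0 \<le> (\<bar>f x\<bar> - \<bar>g x\<bar>)\<^sup>2" by simp
    also have "(\<bar>f x\<bar> - \<bar>g x\<bar>)\<^sup>2 = (f x)\<^sup>2 + (g x)\<^sup>2 - 2 * \<bar>f x * g x\<bar>"
      by (simp add: power2_diff abs_mult)
    finally show "norm (f x * g x) \<le> norm ((f x)\<^sup>2 + (g x)\<^sup>2)" by simp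
  qed
qed (use assms in \<open>auto simp: in_L2_def\<close>)

lemma in_L2_integrable:
  assumes "in_L2 f"
  shows "integrable leb11 f"
  using in_L2_mult_integrable[OF assms in_L2_continuous[OF continuous_on_const[of _ 1]]] by simp

lemma in_L2_add:
  assumes "in_L2 f" "in_L2 g"
  shows "in_L2 (\<lambda>x. f x + g x)"
proof -
  have "integrable leb11 (\<lambda>x. (f x)\<^sup>2 + (g x)\<^sup>2 + 2 * (f x * g x))"
    using assms in_L2_mult_integrable[OF assms] by (auto simp: in_L2_def)
  then have "integrable leb11 (\<lambda>x. (f x + g x)\<^sup>2)" by (simp add: power2_sum mult.assoc)
  then show ?thesis using assms by (auto simp: in_L2_def)
qed

lemma in_L2_cmult: "in_L2 f \<Longrightarrow> in_L2 (\<lambda>x. c * f x)"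
  by (auto simp: in_L2_def power_mult_distrib)

lemma in_L2_diff: "in_L2 f \<Longrightarrow> in_L2 g \<Longrightarrow> in_L2 (\<lambda>x. f x - g x)"
  using in_L2_add[of f "\<lambda>x. (-1) * g x"] in_L2_cmult[of g "-1"] by simp

lemma AE_leb11_not_in_finite:
  assumes "finite F"
  shows "AE x in leb11. x \<notin> F"
proof -
  have "AE x in lebesgue. x \<notin> F"
    using assms by (simp add: AE_not_in negligible_finite flip: negligible_iff_null_sets)
  then show ?thesis by (subst AE_restrict_space_iff) auto
qed

text \<open>
Transfers almost everywhere bounds for \<open>B\<close> to pointwise bounds for its projections, which are
polynomials: every relatively open part of \<open>[-1,1]\<close> has positive measure.
\<close>

lemma AE_leb11_ge_imp_ge:
  fixes p :: "real \<Rightarrow> real"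
  assumes p: "continuous_on UNIV p" and ae: "AE x in leb11. c \<le> p x" and x: "x \<in> {-1..1}"
  shows "c \<le> p x"
proof -
  define C where "C = {x. c \<le> p x}"
  have C: "closed C" unfolding C_def by (intro closed_Collect_le p continuous_on_const)
  have "AE x in lebesgue. x \<in> {-1..1} \<longrightarrow> c \<le> p x" using ae by (subst (asm) AE_restrict_space_iff) auto
  then have "AE x\<in>{-1<..<1} in lebesgue. x \<in> C" by eventually_elim (auto simp: C_def)
  then have "{-1<..<1} \<subseteq> C" using mem_closed_if_AE_lebesgue_open[OF open_greaterThanLessThan C] by blast
  then have "closure {-1<..<1} \<subseteq> C" by (rule closure_minimal[OF _ C])
  with x show ?thesis by (auto simp: C_def closure_greaterThanLessThan)
qed

lemma L2_norm_tendsto_0_iff: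
  "((\<lambda>N. L2_norm (f N)) \<longlonglongrightarrow> 0) \<longleftrightarrow> ((\<lambda>N. LINT x|leb11. (f N x)\<^sup>2) \<longlonglongrightarrow> 0)"
proof
  assume "(\<lambda>N. L2_norm (f N)) \<longlonglongrightarrow> 0"
  then have "(\<lambda>N. (L2_norm (f N))\<^sup>2) \<longlonglongrightarrow> 0\<^sup>2" by (intro tendsto_intros)
  then show "(\<lambda>N. LINT x|leb11. (f N x)\<^sup>2) \<longlonglongrightarrow> 0" by (simp add: L2_norm_def)
next
  assume "(\<lambda>N. LINT x|leb11. (f N x)\<^sup>2) \<longlonglongrightarrow> 0"
  then have "(\<lambda>N. sqrt (LINT x|leb11. (f N x)\<^sup>2)) \<longlonglongrightarrow> sqrt 0" by (intro tendsto_intros)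
  then show "(\<lambda>N. L2_norm (f N)) \<longlonglongrightarrow> 0" by (simp add: L2_norm_def)
qed

lemma L2_norm_sq: "(L2_norm f)\<^sup>2 = (LINT x|leb11. (f x)\<^sup>2)"
  by (simp add: L2_norm_def)

lemma measure_leb11 [simp]: "measure leb11 {-1..1} = 2"
  by (simp add: measure_restrict_space)

lemma leb11_const: "(LINT x|leb11. (c::real)) = 2 * c"
  by (subst leb11_continuous(3)) auto

lemma L1_norm_nonneg: "L1_norm f \<ge> 0"
  by (simp add: L1_norm_def)

text \<open>
Expand \<open>\<integral> (\<bar>f\<bar> - a/2)\<^sup>2 \<ge> 0\<close> with \<open>a = \<parallel>f\<parallel>\<^sub>1\<close>: here \<open>a/2\<close> is the mean of \<open>\<bar>f\<bar>\<close>.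
\<close>

lemma L1_norm_le_L2_norm:
  assumes f: "in_L2 f"
  shows "L1_norm f \<le> sqrt 2 * L2_norm f"
proof -
  define a where "a = L1_norm f"
  have i: "integrable leb11 (\<lambda>x. \<bar>f x\<bar>)" "integrable leb11 (\<lambda>x. (f x)\<^sup>2)" "integrable leb11 (\<lambda>x. (a / 2)\<^sup>2)"
    using in_L2_integrable[OF f] f by (auto simp: in_L2_def intro!: leb11_continuous)
  have "0 \<le> (LINT x|leb11. (\<bar>f x\<bar> - a / 2)\<^sup>2)" by simp
  also have "\<dots> = (LINT x|leb11. (f x)\<^sup>2 - a * \<bar>f x\<bar> + (a / 2)\<^sup>2)"
    by (intro Bochner_Integration.integral_cong) (auto simp: power2_diff)
  also have "\<dots> = (LINT x|leb11. (f x)\<^sup>2) - a * (LINT x|leb11. \<bar>f x\<bar>) + 2 * (a / 2)\<^sup>2"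
    using i by (simp add: leb11_const)
  also have "\<dots> = (LINT x|leb11. (f x)\<^sup>2) - a\<^sup>2 / 2"
    by (simp add: a_def L1_norm_def power2_eq_square)
  finally have "a\<^sup>2 \<le> 2 * (LINT x|leb11. (f x)\<^sup>2)" by simp
  then have "a \<le> sqrt (2 * (LINT x|leb11. (f x)\<^sup>2))" by (rule real_le_rsqrt)
  then show ?thesis by (simp add: a_def L2_norm_def real_sqrt_mult)
qed

lemma L1_tendsto_if_L2_tendsto:
  assumes "\<And>N. in_L2 (f N)" "(\<lambda>N. L2_norm (f N)) \<longlonglongrightarrow> 0"
  shows "(\<lambda>N. L1_norm (f N)) \<longlonglongrightarrow> 0"
proof (rule tendsto_sandwich[where f="\<lambda>_. 0" and h="\<lambda>N. sqrt 2 * L2_norm (f N)"])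
  show "(\<lambda>N. sqrt 2 * L2_norm (f N)) \<longlonglongrightarrow> 0"
    using tendsto_mult_left[OF assms(2), of "sqrt 2"] by simp
qed (use L1_norm_nonneg L1_norm_le_L2_norm[OF assms(1)] in auto)

text \<open>
Both \<open>(f - g) / \<parallel>f\<parallel>\<^sub>1\<close> and \<open>g / \<parallel>f\<parallel>\<^sub>1 - g / \<parallel>g\<parallel>\<^sub>1\<close> have \<open>L\<^sup>1\<close> norm at most
\<open>\<parallel>f - g\<parallel>\<^sub>1 / \<parallel>f\<parallel>\<^sub>1\<close>. The bound remains true if \<open>\<parallel>g\<parallel>\<^sub>1 = 0\<close>, where \<open>g / \<parallel>g\<parallel>\<^sub>1\<close> is \<open>0\<close> by convention.
\<close>

lemma L1_norm_normalized_diff: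
  assumes f: "integrable leb11 f" and g: "integrable leb11 g" and pos: "L1_norm f > 0"
  shows "L1_norm (\<lambda>x. f x / L1_norm f - g x / L1_norm g) \<le> 2 * L1_norm (\<lambda>x. f x - g x) / L1_norm f"
proof -
  define a b d where abd: "a = L1_norm f" "b = L1_norm g" "d = L1_norm (\<lambda>x. f x - g x)"
  have "L1_norm (\<lambda>x. f x / a - g x / b) \<le> (LINT x|leb11. \<bar>f x - g x\<bar> / a + \<bar>g x\<bar> * \<bar>1 / a - 1 / b\<bar>)"
    unfolding L1_norm_def
  proof (intro integral_mono)
    fix x
    have "f x / a - g x / b = (f x - g x) / a + g x * (1 / a - 1 / b)"
      by (simp add: diff_divide_distrib algebra_simps)
    also have "\<bar>\<dots>\<bar> \<le> \<bar>(f x - g x) / a\<bar> + \<bar>g x * (1 / a - 1 / b)\<bar>" by (rule abs_triangle_ineq)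
    also have "\<dots> = \<bar>f x - g x\<bar> / a + \<bar>g x\<bar> * \<bar>1 / a - 1 / b\<bar>"
      using pos by (simp add: abd abs_mult)
    finally show "\<bar>f x / a - g x / b\<bar> \<le> \<bar>f x - g x\<bar> / a + \<bar>g x\<bar> * \<bar>1 / a - 1 / b\<bar>" .
  qed (use f g in auto)
  also have "\<dots> = d / a + b * \<bar>1 / a - 1 / b\<bar>"
    using f g by (simp add: abd L1_norm_def)
  also have "b * \<bar>1 / a - 1 / b\<bar> \<le> d / a"
  proof (cases "b = 0")
    case False
    then have "b > 0" using L1_norm_nonneg[of g] by (simp add: abd)
    have "b * \<bar>1 / a - 1 / b\<bar> = \<bar>b * (1 / a - 1 / b)\<bar>" using \<open>b > 0\<close> by (simp add: abs_mult)
    also have "b * (1 / a - 1 / b) = (b - a) / a" using \<open>b > 0\<close> pos by (simp add: abd field_simps)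
    also have "\<bar>(b - a) / a\<bar> = \<bar>b - a\<bar> / a" using pos by (simp add: abd)
    also have "\<bar>b - a\<bar> \<le> d"
    proof -
      have "b - a = (LINT x|leb11. \<bar>g x\<bar> - \<bar>f x\<bar>)" using f g by (simp add: abd L1_norm_def)
      also have "\<bar>\<dots>\<bar> \<le> (LINT x|leb11. \<bar>\<bar>g x\<bar> - \<bar>f x\<bar>\<bar>)" by (rule integral_abs_bound)
      also have "\<dots> \<le> d" unfolding abd L1_norm_def using f g by (intro integral_mono) auto
      finally show ?thesis .
    qed
    finally show ?thesis using pos by (simp add: abd divide_right_mono)
  qed (use pos L1_norm_nonneg in \<open>simp add: abd\<close>)
  finally show ?thesis by (simp add: abd)
qed

lemma L1_norm_normalized_tendsto:
  assumes "in_L2 f" "\<And>N. in_L2 (g N)" "L1_norm f > 0"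
    and lim: "(\<lambda>N. L2_norm (\<lambda>x. f x - g N x)) \<longlonglongrightarrow> 0"
  shows "(\<lambda>N. L1_norm (\<lambda>x. f x / L1_norm f - g N x / L1_norm (g N))) \<longlonglongrightarrow> 0"
proof (rule tendsto_sandwich[where f="\<lambda>_. 0" and h="\<lambda>N. 2 * L1_norm (\<lambda>x. f x - g N x) / L1_norm f"])
  have "(\<lambda>N. L1_norm (\<lambda>x. f x - g N x)) \<longlonglongrightarrow> 0"
    by (intro L1_tendsto_if_L2_tendsto in_L2_diff assms)
  from tendsto_mult_left[OF this, of "2 / L1_norm f"]
  show "(\<lambda>N. 2 * L1_norm (\<lambda>x. f x - g N x) / L1_norm f) \<longlonglongrightarrow> 0" by simp
qed (use L1_norm_nonneg L1_norm_normalized_diff[OF in_L2_integrable[OF assms(1)] in_L2_integrable[OF assms(2)] assms(3)] in auto)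

section \<open>Orthogonality of the Legendre polynomials\<close>

lemma legendre_0 [simp]: "legendre 0 x = 1"
  by (simp add: legendre_def legendre_poly_def)

lemma finite_abs_legendre_eq_1:
  assumes "l \<noteq> 0"
  shows "finite {x. \<bar>legendre l x\<bar> = 1}"
proof -
  have "legendre_poly l - [:c:] \<noteq> 0" for c
    using assms degree_legendre_poly[of l] by (metis degree_pCons_0 eq_iff_diff_eq_0)
  then have "finite {x. poly (legendre_poly l - [:c:]) x = 0}" for c
    by (rule poly_roots_finite)
  then have "finite {x. legendre l x = c}" for c
    by (simp add: legendre_def)
  then have "finite ({x. legendre l x = 1} \<union> {x. legendre l x = -1})"
    by blast
  moreover have "{x. \<bar>legendre l x\<bar> = 1} = {x. legendre l x = 1} \<union> {x. legendre l x = -1}" by auto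
  ultimately show ?thesis by simp
qed

text \<open>
By Legendre's equation, \<open>(m(m+1) - l(l+1)) P\<^sub>l P\<^sub>m\<close> is the derivative of
\<open>(1 - x\<^sup>2) (P\<^sub>l' P\<^sub>m - P\<^sub>l P\<^sub>m')\<close>, which vanishes at \<open>\<plusminus>1\<close>.
\<close>

lemma legendre_orthogonal:
  assumes "l \<noteq> m"
  shows "(LINT x|leb11. legendre l x * legendre m x) = 0"
proof -
  define p q where pq: "p = legendre_poly l" "q = legendre_poly m"
  define d where "d = real (m * (m + 1)) - real (l * (l + 1))"
  define F where "F x = (1 - x\<^sup>2) * (poly (pderiv p) x * poly q x - poly p x * poly (pderiv q) x)" for x
  have "(F has_real_derivative d * (legendre l x * legendre m x)) (at x)" for x
  proof -
    have "(F has_real_derivative - 2 * x * (poly (pderiv p) x * poly q x - poly p x * poly (pderiv q) x)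
      + (1 - x\<^sup>2) * (poly (pderiv (pderiv p)) x * poly q x - poly p x * poly (pderiv (pderiv q)) x)) (at x)"
      unfolding F_def
      by (rule derivative_eq_intros poly_DERIV refl)+ (simp add: algebra_simps)
    moreover have "- 2 * x * (poly (pderiv p) x * poly q x - poly p x * poly (pderiv q) x)
      + (1 - x\<^sup>2) * (poly (pderiv (pderiv p)) x * poly q x - poly p x * poly (pderiv (pderiv q)) x)
      = (poly (pderiv (pderiv p)) x * (1 - x\<^sup>2)) * poly q x
        - poly p x * (poly (pderiv (pderiv q)) x * (1 - x\<^sup>2))
       - 2 * x * (poly (pderiv p) x * poly q x - poly p x * poly (pderiv q) x)"
      by (simp add: algebra_simps)
    moreover have "\<dots> = d * (poly p x * poly q x)"
      unfolding pq legendre_poly_ode by (simp add: d_def algebra_simps)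
    ultimately show ?thesis by (simp add: legendre_def pq)
  qed
  then have "(LINT x|leb11. d * (legendre l x * legendre m x)) = 0"
    by (subst leb11_FTC[where F=F]) (auto intro!: continuous_intros simp: F_def)
  moreover have "d \<noteq> 0"
  proof -
    have "m * (m + 1) \<noteq> l * (l + 1)"
    proof (cases "l < m")
      case True
      then have "l * (l + 1) < m * (m + 1)" by (intro mult_strict_mono) auto
      then show ?thesis by simp
    next
      case False
      with assms have "m * (m + 1) < l * (l + 1)" by (intro mult_strict_mono) auto
      then show ?thesis by simp
    qed
    then show ?thesis unfolding d_def by (metis of_nat_eq_iff right_minus_eq)
  qed
  ultimately show ?thesis by simp
qed

text \<open>
The coefficient condition says \<open>degree p < N\<close>, but also makes sense for \<open>N = 0\<close>, where it forces \<open>p = 0\<close>;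
this is what lets the induction start without a separate degree-zero case.
\<close>

lemma poly_legendre_span:
  assumes "\<And>n. n \<ge> N \<Longrightarrow> coeff p n = 0"
  shows "\<exists>a. \<forall>x. poly p x = (\<Sum>l<N. a l * legendre l x)"
  using assms
proof (induction N arbitrary: p)
  case 0
  then have "p = 0" by (intro poly_eqI) auto
  then show ?case by simp
next
  case (Suc N)
  define P where "P = legendre_poly N"
  define c where "c = coeff p N / coeff P N"
  have deg: "degree P = N" by (simp add: P_def degree_legendre_poly)
  have "P \<noteq> 0" using legendre_1[of N] by (auto simp: P_def legendre_def)
  then have "coeff P N \<noteq> 0" using leading_coeff_neq_0[of P] deg by simp
  then have "coeff (p - smult c P) n = 0" if "n \<ge> N" for n
    using that Suc.prems[of n] deg by (cases "n = N") (auto simp: c_def coeff_eq_0)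
  from Suc.IH[OF this] obtain a where a: "\<And>x. poly (p - smult c P) x = (\<Sum>l<N. a l * legendre l x)"
    by blast
  have "poly p x = (\<Sum>l<Suc N. (a(N := c)) l * legendre l x)" for x
    using a[of x] by (simp add: legendre_def P_def algebra_simps)
  then show ?case by blast
qed

text \<open>
Integrating \<open>(x P\<^sub>l\<^sup>2)' = P\<^sub>l\<^sup>2 + 2 x P\<^sub>l' P\<^sub>l\<close> gives \<open>2\<close>, as \<open>P\<^sub>l(\<plusminus>1)\<^sup>2 = 1\<close>. Here \<open>x P\<^sub>l' - l P\<^sub>l\<close> has no
coefficient of degree \<open>l\<close> or more, hence is orthogonal to \<open>P\<^sub>l\<close>, and so \<open>(2 l + 1) \<integral> P\<^sub>l\<^sup>2 = 2\<close>.
\<close>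

lemma legendre_sq_integral: "(LINT x|leb11. legendre l x * legendre l x) = 2 / (2 * real l + 1)"
proof -
  define p where "p = legendre_poly l"
  define q where "q = [:0, 1:] * pderiv p - smult (real l) p"
  have "coeff q n = 0" if "n \<ge> l" for n
  proof -
    have "coeff q n = (real n - real l) * coeff p n"
      by (cases n) (auto simp: q_def coeff_pderiv algebra_simps)
    then show ?thesis using that by (cases "n = l") (auto simp: p_def coeff_eq_0 degree_legendre_poly)
  qed
  then obtain a where a: "\<And>x. poly q x = (\<Sum>k<l. a k * legendre k x)"
    using poly_legendre_span by metis
  have "(LINT x|leb11. poly q x * legendre l x) = (LINT x|leb11. (\<Sum>k<l. a k * (legendre k x * legendre l x)))"
    by (simp add: a sum_distrib_right mult.assoc)
  also have "\<dots> = (\<Sum>k<l. LINT x|leb11. a k * (legendre k x * legendre l x))"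
    by (intro Bochner_Integration.integral_sum leb11_continuous continuous_intros)
  also have "\<dots> = 0" by (intro sum.neutral ballI) (simp add: legendre_orthogonal)
  finally have q: "(LINT x|leb11. poly q x * legendre l x) = 0" .
  have "(LINT x|leb11. (2 * real l + 1) * (legendre l x * legendre l x) + 2 * (poly q x * legendre l x))
    = 1 * (legendre l 1)\<^sup>2 - (-1) * (legendre l (-1))\<^sup>2"
  proof (rule leb11_FTC)
    fix x
    have "((\<lambda>x. x * (poly p x)\<^sup>2) has_real_derivative (poly p x)\<^sup>2 + 2 * (x * poly (pderiv p) x) * poly p x) (at x)"
      by (rule derivative_eq_intros poly_DERIV refl)+ (simp add: power2_eq_square algebra_simps)
    moreover have "(poly p x)\<^sup>2 + 2 * (x * poly (pderiv p) x) * poly p x =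
        (2 * real l + 1) * (poly p x * poly p x) + 2 * (poly q x * poly p x)"
      by (simp add: q_def algebra_simps power2_eq_square)
    ultimately show "((\<lambda>x. x * (legendre l x)\<^sup>2) has_real_derivative
       (2 * real l + 1) * (legendre l x * legendre l x) + 2 * (poly q x * legendre l x)) (at x)"
      by (simp add: p_def legendre_def)
  qed (intro continuous_intros)
  moreover have "(LINT x|leb11. (2 * real l + 1) * (legendre l x * legendre l x) + 2 * (poly q x * legendre l x))
     = (2 * real l + 1) * (LINT x|leb11. legendre l x * legendre l x)"
    by (subst Bochner_Integration.integral_add)
      (auto intro!: leb11_continuous continuous_intros simp: q)
  ultimately show ?thesis by (simp add: legendre_1 legendre_minus_1_sq field_simps)
qed

definition legendre_moment :: "(real \<Rightarrow> real) \<Rightarrow> nat \<Rightarrow> real" where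
  "legendre_moment B l = (LINT \<mu>|leb11. B \<mu> * legendre l \<mu>)"

lemma legendre_coeff_eq: "legendre_coeff B l = (2 * real l + 1) / 2 * legendre_moment B l"
  by (simp add: legendre_coeff_def legendre_moment_def)

lemma in_L2_legendre: "in_L2 (legendre l)"
  by (intro in_L2_continuous continuous_intros)

lemma legendre_moment_legendre_sum:
  "legendre_moment (\<lambda>x. \<Sum>l<N. a l * legendre l x) k = (if k < N then 2 / (2 * real k + 1) * a k else 0)"
proof -
  have "legendre_moment (\<lambda>x. \<Sum>l<N. a l * legendre l x) k
      = (LINT x|leb11. (\<Sum>l<N. a l * (legendre l x * legendre k x)))"
    by (simp add: legendre_moment_def sum_distrib_right mult.assoc)
  also have "\<dots> = (\<Sum>l<N. LINT x|leb11. a l * (legendre l x * legendre k x))"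
    by (intro Bochner_Integration.integral_sum leb11_continuous continuous_intros)
  also have "\<dots> = (\<Sum>l<N. if l = k then 2 / (2 * real k + 1) * a k else 0)"
    by (intro sum.cong) (auto simp: legendre_orthogonal legendre_sq_integral)
  finally show ?thesis by simp
qed

lemma L2_dist_legendre_sum:
  assumes B: "in_L2 B"
  shows "(LINT x|leb11. (B x - (\<Sum>l<N. a l * legendre l x))\<^sup>2)
     = (LINT x|leb11. (B x)\<^sup>2) + (\<Sum>l<N. 2 / (2 * real l + 1) * (a l)\<^sup>2 - 2 * a l * legendre_moment B l)"
proof (induction N)
  case (Suc N)
  define S where "S x = (\<Sum>l<N. a l * legendre l x)" for x
  define f where "f x = B x - S x" for x
  have S: "in_L2 S" unfolding S_def by (intro in_L2_continuous continuous_intros)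
  then have f: "in_L2 f" unfolding f_def using B by (intro in_L2_diff)
  have i1: "integrable leb11 (\<lambda>x. f x * legendre N x)" by (rule in_L2_mult_integrable[OF f in_L2_legendre])
  have i2: "integrable leb11 (\<lambda>x. legendre N x * legendre N x)"
    by (rule in_L2_mult_integrable[OF in_L2_legendre in_L2_legendre])
  have "(LINT x|leb11. f x * legendre N x) = (LINT x|leb11. B x * legendre N x - S x * legendre N x)"
    by (simp add: f_def algebra_simps)
  also have "\<dots> = legendre_moment B N - legendre_moment S N"
    unfolding legendre_moment_def
    by (intro Bochner_Integration.integral_diff in_L2_mult_integrable in_L2_legendre B S)
  also have "legendre_moment S N = 0" unfolding S_def legendre_moment_legendre_sum by simp
  finally have m: "(LINT x|leb11. f x * legendre N x) = legendre_moment B N" by simp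
  have "(LINT x|leb11. (B x - (\<Sum>l<Suc N. a l * legendre l x))\<^sup>2)
     = (LINT x|leb11. (f x)\<^sup>2 - 2 * a N * (f x * legendre N x) + (a N)\<^sup>2 * (legendre N x * legendre N x))"
    by (intro Bochner_Integration.integral_cong) (auto simp: f_def S_def power2_eq_square algebra_simps)
  also have "\<dots> = (LINT x|leb11. (f x)\<^sup>2) - 2 * a N * (LINT x|leb11. f x * legendre N x)
      + (a N)\<^sup>2 * (LINT x|leb11. legendre N x * legendre N x)"
    using f i1 i2 by (simp add: in_L2_def)
  also have "\<dots> = (LINT x|leb11. (f x)\<^sup>2) + (2 / (2 * real N + 1) * (a N)\<^sup>2 - 2 * a N * legendre_moment B N)"
    unfolding m legendre_sq_integral by simp
  finally show ?case using Suc.IH by (simp add: f_def S_def)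
qed simp

text \<open>
Bessel's inequality in exact form: the deficit is the squared distance to the projection.
\<close>

lemma L2_dist_legendre_proj:
  assumes B: "in_L2 B"
  shows "(LINT x|leb11. (B x - legendre_proj B N x)\<^sup>2)
     = (LINT x|leb11. (B x)\<^sup>2) - (\<Sum>l\<le>N. (2 * real l + 1) / 2 * (legendre_moment B l)\<^sup>2)"
proof -
  have "2 / (2 * real l + 1) * ((2 * real l + 1) / 2 * m)\<^sup>2 - 2 * ((2 * real l + 1) / 2 * m) * m
     = - ((2 * real l + 1) / 2 * m\<^sup>2)" for l m
  proof -
    define k where "k = 2 * real l + 1"
    have "k \<noteq> 0" by (simp add: k_def)
    then show ?thesis unfolding k_def[symmetric] by (simp add: power2_eq_square field_simps)
  qed
  then show ?thesis
    using L2_dist_legendre_sum[OF B, where N="Suc N" and a="legendre_coeff B"]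
    by (simp add: legendre_proj_def legendre_coeff_eq lessThan_Suc_atMost sum_negf del: sum.lessThan_Suc)
qed

text \<open>
Completing the square in each coefficient \<open>a\<^sub>l\<close> shows that the distance is least when \<open>a\<^sub>l\<close> is the Legendre
coefficient.
\<close>

lemma legendre_proj_best_approx:
  assumes B: "in_L2 B"
  shows "(LINT x|leb11. (B x - legendre_proj B N x)\<^sup>2) \<le> (LINT x|leb11. (B x - (\<Sum>l<Suc N. a l * legendre l x))\<^sup>2)"
proof -
  have "- ((2 * real l + 1) / 2 * m\<^sup>2) \<le> 2 / (2 * real l + 1) * c\<^sup>2 - 2 * c * m" for l c m
  proof -
    define k where "k = 2 * real l + 1"
    have "k > 0" by (simp add: k_def)
    have "0 \<le> 2 / k * (c - k / 2 * m)\<^sup>2" using \<open>k > 0\<close> by simp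
    also have "\<dots> = 2 / k * c\<^sup>2 - 2 * c * m + k / 2 * m\<^sup>2"
      using \<open>k > 0\<close> by (simp add: power2_eq_square field_simps)
    finally show ?thesis by (simp add: k_def)
  qed
  then have "(\<Sum>l<Suc N. - ((2 * real l + 1) / 2 * (legendre_moment B l)\<^sup>2))
     \<le> (\<Sum>l<Suc N. 2 / (2 * real l + 1) * (a l)\<^sup>2 - 2 * a l * legendre_moment B l)"
    by (intro sum_mono)
  then show ?thesis
    unfolding L2_dist_legendre_sum[OF B] L2_dist_legendre_proj[OF B]
    by (simp add: lessThan_Suc_atMost sum_negf del: sum.lessThan_Suc)
qed

section \<open>Completeness of the Legendre polynomials\<close>

lemma L2_approx_bounded:
  assumes f: "in_L2 f" and e: "e > 0"
  shows "\<exists>n::nat. (LINT x|leb11. (f x - max (- real n) (min (real n) (f x)))\<^sup>2) < e"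
proof -
  have "(\<lambda>n. LINT x|leb11. (f x - max (- real n) (min (real n) (f x)))\<^sup>2) \<longlonglongrightarrow> (LINT x|leb11. 0)"
  proof (rule integral_dominated_convergence[where w="\<lambda>x. (f x)\<^sup>2"])
    show "AE x in leb11. (\<lambda>n. (f x - max (- real n) (min (real n) (f x)))\<^sup>2) \<longlonglongrightarrow> 0"
    proof (intro AE_I2 tendsto_eventually)
      fix x
      show "\<forall>\<^sub>F n in sequentially. (f x - max (- real n) (min (real n) (f x)))\<^sup>2 = 0"
        using eventually_ge_at_top[of "nat \<lceil>\<bar>f x\<bar>\<rceil>"]
      proof eventually_elim
        case (elim n)
        then have "\<bar>f x\<bar> \<le> real n" by linarith
        then show ?case by simp
      qed
    qed
    show "AE x in leb11. norm ((f x - max (- real n) (min (real n) (f x)))\<^sup>2) \<le> (f x)\<^sup>2" for n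
    proof (intro AE_I2)
      fix x
      have "\<bar>f x - max (- real n) (min (real n) (f x))\<bar> \<le> \<bar>f x\<bar>" by linarith
      then have "\<bar>f x - max (- real n) (min (real n) (f x))\<bar>\<^sup>2 \<le> \<bar>f x\<bar>\<^sup>2" by (intro power_mono) auto
      then show "norm ((f x - max (- real n) (min (real n) (f x)))\<^sup>2) \<le> (f x)\<^sup>2" by simp
    qed
  qed (use f in \<open>auto simp: in_L2_def\<close>)
  then have "\<forall>\<^sub>F n in sequentially. (LINT x|leb11. (f x - max (- real n) (min (real n) (f x)))\<^sup>2) < e"
    using e by (intro order_tendstoD) auto
  then show ?thesis by (auto dest: eventually_happens)
qed

text \<open>
A measurable function is an almost everywhere limit of continuous functions. Clamping these to
\<open>[-M,M]\<close> does not change the limit, and makes dominated convergence applicable.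
\<close>

lemma L2_approx_continuous:
  fixes f :: "real \<Rightarrow> real"
  assumes f: "f \<in> borel_measurable leb11" and bd: "\<And>x. \<bar>f x\<bar> \<le> M" and e: "e > 0"
  shows "\<exists>g. continuous_on UNIV g \<and> (LINT x|leb11. (f x - g x)\<^sup>2) < e"
proof -
  have "f measurable_on {-1..1}"
    using f measurable_on_iff_borel_measurable[of "{-1..1}" f] by simp
  then obtain N g where N: "negligible N" and g: "\<And>n. continuous_on UNIV (g n)"
    and lim: "\<And>x. x \<notin> N \<Longrightarrow> (\<lambda>n::nat. g n x) \<longlonglongrightarrow> (if x \<in> {-1..1} then f x else 0)"
    unfolding measurable_on_def by blast
  define h where "h n x = max (- M) (min M (g n x))" for n x
  have h: "continuous_on S (h n)" for S n
    unfolding h_def using continuous_on_subset[OF g] by (intro continuous_intros) auto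
  have "M \<ge> 0" using bd[of 0] by linarith
  have "(\<lambda>n. LINT x|leb11. (f x - h n x)\<^sup>2) \<longlonglongrightarrow> (LINT x|leb11. 0)"
  proof (rule integral_dominated_convergence[where w="\<lambda>x. (2 * M)\<^sup>2"])
    have "AE x in lebesgue. x \<notin> N" using N by (simp add: AE_not_in negligible_iff_null_sets)
    then have "AE x in leb11. x \<notin> N \<and> x \<in> {-1..1}" by (subst AE_restrict_space_iff) auto
    then show "AE x in leb11. (\<lambda>n. (f x - h n x)\<^sup>2) \<longlonglongrightarrow> 0"
    proof eventually_elim
      case (elim x)
      then have "(\<lambda>n. g n x) \<longlonglongrightarrow> f x" using lim[of x] by simp
      then have "(\<lambda>n. (f x - h n x)\<^sup>2) \<longlonglongrightarrow> (f x - max (- M) (min M (f x)))\<^sup>2"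
        unfolding h_def by (intro tendsto_intros)
      also have "max (- M) (min M (f x)) = f x" using bd[of x] by linarith
      finally show ?case by simp
    qed
    show "AE x in leb11. norm ((f x - h n x)\<^sup>2) \<le> (2 * M)\<^sup>2" for n
    proof (intro AE_I2)
      fix x
      have "\<bar>f x - h n x\<bar> \<le> 2 * M" using bd[of x] \<open>M \<ge> 0\<close> unfolding h_def by linarith
      then have "\<bar>f x - h n x\<bar>\<^sup>2 \<le> (2 * M)\<^sup>2" by (intro power_mono) auto
      then show "norm ((f x - h n x)\<^sup>2) \<le> (2 * M)\<^sup>2" by simp
    qed
    show "integrable leb11 (\<lambda>x. (2 * M)\<^sup>2)" by (intro leb11_continuous continuous_intros)
    show "(\<lambda>x. (f x - h n x)\<^sup>2) \<in> borel_measurable leb11" for n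
      using f leb11_continuous(1)[OF h] by measurable
  qed auto
  then have "\<forall>\<^sub>F n in sequentially. (LINT x|leb11. (f x - h n x)\<^sup>2) < e"
    using e by (intro order_tendstoD) auto
  then obtain n where "(LINT x|leb11. (f x - h n x)\<^sup>2) < e" by (auto dest: eventually_happens)
  with h show ?thesis by blast
qed

text \<open>
Three approximations, each with squared error at most \<open>e/9\<close>: truncate \<open>f\<close> to a bounded function, replace that by a
continuous function, and that by a polynomial (Stone--Weierstrass). The factor \<open>9 = 3 \<cdot> 3\<close> comes from
\<open>(\<alpha> + \<beta> + \<gamma>)\<^sup>2 \<le> 3 (\<alpha>\<^sup>2 + \<beta>\<^sup>2 + \<gamma>\<^sup>2)\<close>.
\<close>

lemma L2_approx_poly:
  assumes f: "in_L2 f" and e: "e > 0"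
  shows "\<exists>p. (LINT x|leb11. (f x - poly p x)\<^sup>2) < e"
proof -
  obtain n :: nat where n: "(LINT x|leb11. (f x - max (- real n) (min (real n) (f x)))\<^sup>2) < e / 9"
    using L2_approx_bounded[OF f, of "e / 9"] e by auto
  define u where "u x = max (- real n) (min (real n) (f x))" for x
  have um: "u \<in> borel_measurable leb11" unfolding u_def using in_L2_measurable[OF f] by measurable
  have ub: "\<bar>u x\<bar> \<le> real n" for x unfolding u_def by linarith
  have u: "in_L2 u"
    unfolding in_L2_def
  proof (intro conjI um)
    have "(u x)\<^sup>2 \<le> (real n)\<^sup>2" for x using power_mono[OF ub[of x], of 2] by simp
    then show "integrable leb11 (\<lambda>x. (u x)\<^sup>2)"
      using um by (intro finite_measure.integrable_const_bound[OF finite_measure_leb11, of _ "(real n)\<^sup>2"]) auto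
  qed
  obtain g where gc: "continuous_on UNIV g" and g: "(LINT x|leb11. (u x - g x)\<^sup>2) < e / 9"
    using L2_approx_continuous[OF um ub, of "e / 9"] e by auto
  have gc': "continuous_on {-1..1} g" using gc continuous_on_subset by blast
  obtain q where q: "real_polynomial_function q" "\<And>x. x \<in> {-1..1} \<Longrightarrow> \<bar>g x - q x\<bar> < sqrt (e / 18)"
    using Stone_Weierstrass_real_polynomial_function[OF _ gc', of "sqrt (e / 18)"] e by auto
  obtain a m where a: "q = (\<lambda>x. \<Sum>i\<le>(m::nat). a i * x ^ i)"
    using q(1) real_polynomial_function_iff_sum by blast
  define p where "p = (\<Sum>i\<le>m. monom (a i) i)"
  have p: "poly p x = q x" for x by (simp add: p_def a poly_sum poly_monom)
  have gL: "in_L2 g" by (rule in_L2_continuous[OF gc'])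
  have pL: "in_L2 (poly p)" by (intro in_L2_continuous continuous_intros)
  have i1: "integrable leb11 (\<lambda>x. (f x - u x)\<^sup>2)" "integrable leb11 (\<lambda>x. (u x - g x)\<^sup>2)"
    "integrable leb11 (\<lambda>x. (g x - poly p x)\<^sup>2)" "integrable leb11 (\<lambda>x. (f x - poly p x)\<^sup>2)"
    using in_L2_diff f u gL pL by (auto simp: in_L2_def)
  have "(LINT x|leb11. (g x - poly p x)\<^sup>2) \<le> (LINT x|leb11. e / 18)"
  proof (intro integral_mono i1)
    fix x assume "x \<in> space leb11"
    then have "\<bar>g x - poly p x\<bar> \<le> sqrt (e / 18)" using q(2)[of x] p by simp
    then have "\<bar>g x - poly p x\<bar>\<^sup>2 \<le> (sqrt (e / 18))\<^sup>2" by (intro power_mono) auto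
    then show "(g x - poly p x)\<^sup>2 \<le> e / 18" using e by simp
  qed (intro leb11_continuous continuous_intros)
  also have "\<dots> = e / 9" by (subst leb11_continuous(3)) (auto intro!: continuous_intros)
  finally have i2: "(LINT x|leb11. (g x - poly p x)\<^sup>2) \<le> e / 9" .
  have "(LINT x|leb11. (f x - poly p x)\<^sup>2)
    \<le> (LINT x|leb11. 3 * (f x - u x)\<^sup>2 + 3 * (u x - g x)\<^sup>2 + 3 * (g x - poly p x)\<^sup>2)"
  proof (intro integral_mono)
    fix x
    define \<alpha> \<beta> \<gamma> where abg: "\<alpha> = f x - u x" "\<beta> = u x - g x" "\<gamma> = g x - poly p x"
    have "0 \<le> (\<alpha> - \<beta>)\<^sup>2 + (\<beta> - \<gamma>)\<^sup>2 + (\<alpha> - \<gamma>)\<^sup>2" by simp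
    then have "(\<alpha> + \<beta> + \<gamma>)\<^sup>2 \<le> 3 * \<alpha>\<^sup>2 + 3 * \<beta>\<^sup>2 + 3 * \<gamma>\<^sup>2"
      by (simp add: power2_eq_square algebra_simps)
    then show "(f x - poly p x)\<^sup>2 \<le> 3 * (f x - u x)\<^sup>2 + 3 * (u x - g x)\<^sup>2 + 3 * (g x - poly p x)\<^sup>2"
      by (simp add: abg)
  qed (use i1 in auto)
  also have "\<dots> = 3 * (LINT x|leb11. (f x - u x)\<^sup>2) + 3 * (LINT x|leb11. (u x - g x)\<^sup>2)
      + 3 * (LINT x|leb11. (g x - poly p x)\<^sup>2)"
    using i1 by simp
  also have "\<dots> < e" using n g i2 by (simp add: u_def)
  finally show ?thesis by blast
qed

text \<open>
A polynomial of degree at most \<open>N\<close> is a combination of \<open>P\<^sub>0, \<dots>, P\<^sub>N\<close>, hence no closer to \<open>B\<close> than the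
projection of order \<open>N\<close>; and polynomials are dense.
\<close>

theorem legendre_proj_tendsto:
  assumes B: "in_L2 B"
  shows "(\<lambda>N. LINT x|leb11. (B x - legendre_proj B N x)\<^sup>2) \<longlonglongrightarrow> 0"
proof (rule LIMSEQ_I)
  fix e :: real assume "e > 0"
  then obtain p where p: "(LINT x|leb11. (B x - poly p x)\<^sup>2) < e" using L2_approx_poly[OF B] by blast
  have "norm ((LINT x|leb11. (B x - legendre_proj B N x)\<^sup>2) - 0) < e" if N: "N \<ge> degree p" for N
  proof -
    have "coeff p n = 0" if "n \<ge> Suc N" for n using that N by (intro coeff_eq_0) simp
    then obtain a where "\<And>x. poly p x = (\<Sum>l<Suc N. a l * legendre l x)"
      using poly_legendre_span by metis
    then have "(LINT x|leb11. (B x - legendre_proj B N x)\<^sup>2) < e"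
      using legendre_proj_best_approx[OF B, of N a] p by simp
    then show ?thesis by simp
  qed
  then show "\<exists>no. \<forall>n\<ge>no. norm ((LINT x|leb11. (B x - legendre_proj B n x)\<^sup>2) - 0) < e" by blast
qed

section \<open>Moments of a nonnegative kernel\<close>

locale collision_kernel =
  fixes B :: "real \<Rightarrow> real"
  assumes B_L2: "in_L2 B"
    and B_nonneg: "AE \<mu> in leb11. B \<mu> \<ge> 0"
    and B_nonzero: "\<not> (AE \<mu> in leb11. B \<mu> = 0)"
begin

abbreviation m :: "nat \<Rightarrow> real" where "m \<equiv> legendre_moment B"

abbreviation S :: "nat \<Rightarrow> real \<Rightarrow> real" where "S \<equiv> legendre_proj B"

lemma moment_0: "m 0 = (LINT x|leb11. B x)"
  by (simp add: legendre_moment_def)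

lemma moment_0_pos: "m 0 > 0"
proof -
  have "(LINT x|leb11. B x) \<noteq> 0"
    using B_nonzero integral_nonneg_eq_0_iff_AE[OF in_L2_integrable[OF B_L2] B_nonneg] by blast
  moreover have "(LINT x|leb11. B x) \<ge> 0" by (rule integral_nonneg_AE[OF B_nonneg])
  ultimately show ?thesis by (simp add: moment_0)
qed

lemma abs_moment_le_integral: "\<bar>m l\<bar> \<le> (LINT x|leb11. B x * \<bar>legendre l x\<bar>)"
proof -
  have "\<bar>m l\<bar> \<le> (LINT x|leb11. \<bar>B x * legendre l x\<bar>)"
    unfolding legendre_moment_def by (rule integral_abs_bound)
  also have "\<dots> = (LINT x|leb11. B x * \<bar>legendre l x\<bar>)"
  proof (rule integral_cong_AE)
    show "AE x in leb11. \<bar>B x * legendre l x\<bar> = B x * \<bar>legendre l x\<bar>"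
      using B_nonneg by eventually_elim (simp add: abs_mult)
  qed (use in_L2_measurable[OF B_L2] in_L2_measurable[OF in_L2_legendre] in measurable)
  finally show ?thesis .
qed

lemma integrable_B_abs_legendre:
  "integrable leb11 (\<lambda>x. B x * \<bar>legendre l x\<bar>)"
  by (intro in_L2_mult_integrable B_L2 in_L2_continuous continuous_intros)

text \<open>
The difference of the two sides is at least \<open>\<integral> B (1 - \<bar>P\<^sub>l\<bar>)\<close>. Its integrand is nonnegative and is not almost
everywhere \<open>0\<close>, because \<open>\<bar>P\<^sub>l\<bar> = 1\<close> only at finitely many points.
\<close>

lemma abs_moment_less:
  assumes "l \<noteq> 0"
  shows "\<bar>m l\<bar> < m 0"
proof -
  define gap where "gap x = B x * (1 - \<bar>legendre l x\<bar>)" for x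
  have gap: "integrable leb11 gap" unfolding gap_def
    by (intro in_L2_mult_integrable B_L2 in_L2_continuous continuous_intros)
  have "AE x in leb11. x \<in> {-1..1}" by (rule AE_I2) simp
  with B_nonneg have nn: "AE x in leb11. 0 \<le> gap x"
    by eventually_elim (simp add: gap_def abs_legendre_le_1)
  have "\<not> (AE x in leb11. gap x = 0)"
  proof
    assume "AE x in leb11. gap x = 0"
    with AE_leb11_not_in_finite[OF finite_abs_legendre_eq_1[OF assms]]
    have "AE x in leb11. B x = 0" by eventually_elim (auto simp: gap_def)
    with B_nonzero show False ..
  qed
  then have "(LINT x|leb11. gap x) > 0"
    using integral_nonneg_AE[OF nn] integral_nonneg_eq_0_iff_AE[OF gap nn] by simp
  also have "(LINT x|leb11. gap x) = (LINT x|leb11. B x - B x * \<bar>legendre l x\<bar>)"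
    by (simp add: gap_def algebra_simps)
  also have "\<dots> = m 0 - (LINT x|leb11. B x * \<bar>legendre l x\<bar>)"
    unfolding moment_0 by (intro Bochner_Integration.integral_diff in_L2_integrable[OF B_L2] integrable_B_abs_legendre)
  finally show ?thesis using abs_moment_le_integral[of l] by simp
qed

lemma abs_moment_le: "\<bar>m l\<bar> \<le> m 0"
  using abs_moment_less[of l] moment_0_pos by (cases "l = 0") auto

text \<open>
The \<open>l\<close>-th summand in Parseval's identity, that is, the squared \<open>L\<^sup>2\<close> norm of \<open>B\<^sub>l P\<^sub>l\<close>.
\<close>

definition energy :: "nat \<Rightarrow> real" where "energy l = (2 * real l + 1) / 2 * (m l)\<^sup>2"

lemma energy_nonneg: "energy l \<ge> 0" by (simp add: energy_def)

definition proj_error :: "nat \<Rightarrow> real" where "proj_error N = (LINT x|leb11. (B x - S N x)\<^sup>2)"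

lemma proj_error_eq: "proj_error N = (LINT x|leb11. (B x)\<^sup>2) - (\<Sum>l\<le>N. energy l)"
  by (simp add: proj_error_def energy_def L2_dist_legendre_proj[OF B_L2])

lemma proj_error_nonneg: "proj_error N \<ge> 0" by (simp add: proj_error_def)

lemma proj_error_tendsto: "proj_error \<longlonglongrightarrow> 0"
  unfolding proj_error_def by (rule legendre_proj_tendsto[OF B_L2])

lemma sum_energy_le: "(\<Sum>l<N. energy l) \<le> (LINT x|leb11. (B x)\<^sup>2)"
proof -
  have "(\<Sum>l<N. energy l) \<le> (\<Sum>l\<le>N. energy l)" by (intro sum_mono2) (auto simp: energy_nonneg)
  then show ?thesis using proj_error_eq[of N] proj_error_nonneg[of N] by simp
qed

lemma summable_energy: "summable energy"
  by (rule summableI_nonneg_bounded[OF energy_nonneg sum_energy_le])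

lemma summable_energy_tail: "summable (\<lambda>l. energy (l + N))"
  using summable_energy by (simp add: summable_iff_shift)

lemma energy_tail_le: "(\<Sum>l. energy (l + Suc N)) \<le> proj_error N"
proof -
  have "suminf energy \<le> (LINT x|leb11. (B x)\<^sup>2)" by (rule suminf_le_const[OF summable_energy sum_energy_le])
  then show ?thesis
    using suminf_split_initial_segment[OF summable_energy, of "Suc N"] proj_error_eq[of N]
    by (simp add: lessThan_Suc_atMost del: sum.lessThan_Suc)
qed

text \<open>
A Riemann--Lebesgue lemma: the moments are square-summable even with the weights \<open>(2 l + 1) / 2\<close>.
\<close>

lemma moment_tendsto_0: "m \<longlonglongrightarrow> 0"
proof -
  have "(\<lambda>l. 2 * energy l) \<longlonglongrightarrow> 0"
    using tendsto_mult_left[OF summable_LIMSEQ_zero[OF summable_energy], of 2] by simp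
  moreover have "(m l)\<^sup>2 \<le> 2 * energy l" for l
    using mult_right_mono[of 1 "2 * real l + 1" "(m l)\<^sup>2"] by (simp add: energy_def)
  ultimately have "(\<lambda>l. (m l)\<^sup>2) \<longlonglongrightarrow> 0"
    by (intro tendsto_sandwich[where f="\<lambda>_. 0" and h="\<lambda>l. 2 * energy l" and g="\<lambda>l. (m l)\<^sup>2"]
        always_eventually allI tendsto_const) auto
  then have "(\<lambda>l. sqrt ((m l)\<^sup>2)) \<longlonglongrightarrow> sqrt 0" by (intro tendsto_intros)
  then show ?thesis by (simp add: tendsto_rabs_zero_iff)
qed

end

section \<open>The Green's function as the kernel plus a continuous remainder\<close>

lemma abs_exp_minus_linear_le: "\<bar>exp x - 1 - x\<bar> \<le> x\<^sup>2 / 2 * exp \<bar>x\<bar>" for x :: real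
proof -
  obtain t where t: "\<bar>t\<bar> \<le> \<bar>x\<bar>" "exp x = (\<Sum>m<2. (x ^ m) / fact m) + (exp t / fact 2) * x ^ 2"
    using Maclaurin_exp_le by blast
  have "\<bar>exp x - 1 - x\<bar> = x\<^sup>2 / 2 * exp t"
    using t(2) by (simp add: numeral_2_eq_2)
  also have "exp t \<le> exp \<bar>x\<bar>" using t(1) by simp
  finally show ?thesis by (simp add: mult_left_mono)
qed

context collision_kernel
begin

lemma lambda_coll_eq: "lambda_coll B l = 2 * pi * (m 0 - m l)"
proof -
  have "(LINT x|leb11. B x * (1 - legendre l x)) = (LINT x|leb11. B x - B x * legendre l x)"
    by (simp add: algebra_simps)
  also have "\<dots> = m 0 - m l"
    unfolding moment_0 by (simp add: legendre_moment_def in_L2_integrable[OF B_L2] in_L2_mult_integrable[OF B_L2 in_L2_legendre])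
  finally show ?thesis by (simp add: lambda_coll_def)
qed

lemma K_coll_eq: "K_coll B = 2 * pi * m 0"
proof -
  have "(\<lambda>l. 2 * pi * (m 0 - m l)) \<longlonglongrightarrow> 2 * pi * (m 0 - 0)"
    by (intro tendsto_intros moment_tendsto_0)
  moreover have "lambda_coll B = (\<lambda>l. 2 * pi * (m 0 - m l))" by (simp add: fun_eq_iff lambda_coll_eq)
  ultimately have "lambda_coll B \<longlonglongrightarrow> 2 * pi * m 0" by simp
  then show ?thesis unfolding K_coll_def by (rule limI)
qed

abbreviation K :: real where "K \<equiv> K_coll B"

lemma K_pos: "K > 0" by (simp add: K_coll_eq moment_0_pos)

lemma Gc_trunc_eq:
  "Gc_trunc B N t \<mu> = exp (- K * t) *
     (\<Sum>l\<le>N. (2 * real l + 1) / (4 * pi) * (exp (2 * pi * m l * t) - 1) * legendre l \<mu>)"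
proof -
  have "exp (- lambda_coll B l * t) - exp (- K * t) = exp (- K * t) * (exp (2 * pi * m l * t) - 1)" for l
    by (simp add: lambda_coll_eq K_coll_eq algebra_simps flip: exp_add)
  then show ?thesis by (simp add: Gc_trunc_def sum_distrib_left mult_ac)
qed

text \<open>
The part of the \<open>l\<close>-th coefficient of \<open>G\<^sup>c(t)\<close> that remains after subtracting its first-order Taylor
term; those terms add up to \<open>exp (- K t) t B\<close>.
\<close>

definition remainder_coeff :: "real \<Rightarrow> nat \<Rightarrow> real" where
  "remainder_coeff t l = (2 * real l + 1) / (4 * pi) * (exp (- K * t) * (exp (2 * pi * m l * t) - 1 - 2 * pi * m l * t))"

lemma Gc_trunc_split: "Gc_trunc B N t \<mu> = exp (- K * t) * t * S N \<mu> + (\<Sum>l\<le>N. remainder_coeff t l * legendre l \<mu>)"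
proof -
  have "exp (- K * t) * ((2 * real l + 1) / (4 * pi) * (exp (2 * pi * m l * t) - 1) * legendre l \<mu>)
    = exp (- K * t) * t * (legendre_coeff B l * legendre l \<mu>) + remainder_coeff t l * legendre l \<mu>" for l
    by (simp add: remainder_coeff_def legendre_coeff_eq field_simps)
  then show ?thesis
    unfolding Gc_trunc_eq legendre_proj_def sum_distrib_left by (simp add: sum.distrib)
qed

text \<open>
With \<open>x = 2\<pi> t \<cdot> m l\<close>, Taylor's formula gives \<open>\<bar>exp x - 1 - x\<bar> \<le> x\<^sup>2/2 exp \<bar>x\<bar>\<close>, and \<open>\<bar>x\<bar> \<le> K t\<close> because
\<open>\<bar>m l\<bar> \<le> m 0\<close>. So the factor \<open>exp (- K t)\<close> cancels the exponential, and the bound has no constant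
that grows with \<open>t\<close> exponentially.
\<close>

lemma abs_remainder_coeff_le:
  assumes "t \<ge> 0"
  shows "\<bar>remainder_coeff t l\<bar> \<le> pi * t\<^sup>2 * energy l"
proof -
  define x where "x = 2 * pi * m l * t"
  have "\<bar>x\<bar> \<le> K * t"
    using assms abs_moment_le[of l] by (simp add: x_def K_coll_eq abs_mult mult_right_mono)
  then have ex: "exp (- K * t) * exp \<bar>x\<bar> \<le> 1" by (simp flip: exp_add)
  have "exp (- K * t) * \<bar>exp x - 1 - x\<bar> \<le> exp (- K * t) * (x\<^sup>2 / 2 * exp \<bar>x\<bar>)"
    by (intro mult_left_mono abs_exp_minus_linear_le) auto
  also have "\<dots> = (exp (- K * t) * exp \<bar>x\<bar>) * (x\<^sup>2 / 2)" by simp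
  also have "\<dots> \<le> 1 * (x\<^sup>2 / 2)" by (intro mult_right_mono ex) auto
  finally have "exp (- K * t) * \<bar>exp x - 1 - x\<bar> \<le> x\<^sup>2 / 2" by simp
  then have "(2 * real l + 1) / (4 * pi) * (exp (- K * t) * \<bar>exp x - 1 - x\<bar>) \<le> (2 * real l + 1) / (4 * pi) * (x\<^sup>2 / 2)"
    by (intro mult_left_mono) auto
  also have "(2 * real l + 1) / (4 * pi) * (x\<^sup>2 / 2) = pi * t\<^sup>2 * energy l"
    by (simp add: x_def energy_def power2_eq_square field_simps)
  finally show ?thesis by (simp add: remainder_coeff_def x_def abs_mult)
qed

lemma abs_remainder_term_le:
  assumes "t \<ge> 0" "\<mu> \<in> {-1..1}"
  shows "\<bar>remainder_coeff t l * legendre l \<mu>\<bar> \<le> pi * t\<^sup>2 * energy l"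
proof -
  have "\<bar>remainder_coeff t l\<bar> * \<bar>legendre l \<mu>\<bar> \<le> (pi * t\<^sup>2 * energy l) * 1"
    by (intro mult_mono abs_remainder_coeff_le abs_legendre_le_1 assms) (auto simp: energy_nonneg)
  then show ?thesis by (simp add: abs_mult)
qed

definition remainder :: "real \<Rightarrow> real \<Rightarrow> real" where "remainder t \<mu> = (\<Sum>l. remainder_coeff t l * legendre l \<mu>)"

lemma summable_remainder:
  assumes "t \<ge> 0" "\<mu> \<in> {-1..1}"
  shows "summable (\<lambda>l. remainder_coeff t l * legendre l \<mu>)"
  by (rule summable_comparison_test'[where g="\<lambda>l. pi * t\<^sup>2 * energy l"])
    (use abs_remainder_term_le[OF assms] summable_energy in \<open>auto intro: summable_mult\<close>)

lemma abs_remainder_tail_le: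
  assumes "t \<ge> 0" "\<mu> \<in> {-1..1}"
  shows "\<bar>remainder t \<mu> - (\<Sum>l\<le>N. remainder_coeff t l * legendre l \<mu>)\<bar> \<le> pi * t\<^sup>2 * proj_error N"
proof -
  have sm: "summable (\<lambda>l. pi * t\<^sup>2 * energy (l + Suc N))" by (intro summable_mult summable_energy_tail)
  have b: "norm (remainder_coeff t (l + Suc N) * legendre (l + Suc N) \<mu>) \<le> pi * t\<^sup>2 * energy (l + Suc N)" for l
    using abs_remainder_term_le[OF assms] by simp
  have "remainder t \<mu> - (\<Sum>l\<le>N. remainder_coeff t l * legendre l \<mu>) = (\<Sum>l. remainder_coeff t (l + Suc N) * legendre (l + Suc N) \<mu>)"
    unfolding remainder_def using suminf_split_initial_segment[OF summable_remainder[OF assms], of "Suc N"]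
    by (simp add: lessThan_Suc_atMost del: sum.lessThan_Suc)
  also have "\<bar>\<dots>\<bar> \<le> (\<Sum>l. pi * t\<^sup>2 * energy (l + Suc N))"
    using norm_suminf_le[OF b sm] by simp
  also have "\<dots> = pi * t\<^sup>2 * (\<Sum>l. energy (l + Suc N))"
    by (rule suminf_mult[OF summable_energy_tail])
  also have "\<dots> \<le> pi * t\<^sup>2 * proj_error N" by (intro mult_left_mono energy_tail_le) auto
  finally show ?thesis .
qed

lemma continuous_remainder:
  assumes "t \<ge> 0"
  shows "continuous_on {-1..1} (remainder t)"
proof (rule uniform_limit_theorem)
  show "uniform_limit {-1..1} (\<lambda>n \<mu>. \<Sum>l<n. remainder_coeff t l * legendre l \<mu>) (remainder t) sequentially"
    unfolding remainder_def
    by (rule Weierstrass_m_test[where M="\<lambda>l. pi * t\<^sup>2 * energy l"])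
      (use abs_remainder_term_le[OF assms] summable_energy in \<open>auto intro: summable_mult\<close>)
  show "\<forall>\<^sub>F n in sequentially. continuous_on {-1..1} (\<lambda>\<mu>. \<Sum>l<n. remainder_coeff t l * legendre l \<mu>)"
    by (intro always_eventually allI continuous_intros)
qed simp

text \<open>
An explicit representative of \<open>G\<^sup>c(t)\<close> in which a multiple of \<open>B\<close> carries all the irregularity: the second
summand is continuous.
\<close>

definition Gc_rep :: "real \<Rightarrow> real \<Rightarrow> real" where "Gc_rep t \<mu> = exp (- K * t) * t * B \<mu> + remainder t \<mu>"

lemma Gc_rep_in_L2: "t \<ge> 0 \<Longrightarrow> in_L2 (Gc_rep t)"
  unfolding Gc_rep_def by (intro in_L2_add in_L2_cmult B_L2 in_L2_continuous continuous_remainder)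

lemma continuous_Gc_trunc: "continuous_on A (Gc_trunc B N t)"
  unfolding Gc_trunc_def by (intro continuous_intros)

lemma continuous_proj: "continuous_on A (S N)"
  unfolding legendre_proj_def by (intro continuous_intros)

lemma Gc_rep_diff_le:
  assumes "t \<ge> 0" "\<mu> \<in> {-1..1}"
  shows "\<bar>Gc_rep t \<mu> - Gc_trunc B N t \<mu>\<bar> \<le> t * \<bar>B \<mu> - S N \<mu>\<bar> + pi * t\<^sup>2 * proj_error N"
proof -
  have "Gc_rep t \<mu> - Gc_trunc B N t \<mu> = exp (- K * t) * (t * (B \<mu> - S N \<mu>))
       + (remainder t \<mu> - (\<Sum>l\<le>N. remainder_coeff t l * legendre l \<mu>))"
    by (simp add: Gc_rep_def Gc_trunc_split algebra_simps)
  also have "\<bar>\<dots>\<bar> \<le> \<bar>exp (- K * t) * (t * (B \<mu> - S N \<mu>))\<bar> + pi * t\<^sup>2 * proj_error N"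
    by (intro order.trans[OF abs_triangle_ineq] add_left_mono abs_remainder_tail_le assms)
  also have "\<bar>exp (- K * t) * (t * (B \<mu> - S N \<mu>))\<bar> = exp (- K * t) * (t * \<bar>B \<mu> - S N \<mu>\<bar>)"
    using assms by (simp add: abs_mult)
  also have "\<dots> \<le> 1 * (t * \<bar>B \<mu> - S N \<mu>\<bar>)"
    using assms K_pos by (intro mult_right_mono) auto
  finally show ?thesis by simp
qed

lemma Gc_rep_tendsto:
  assumes "t \<ge> 0"
  shows "(\<lambda>N. LINT \<mu>|leb11. (Gc_rep t \<mu> - Gc_trunc B N t \<mu>)\<^sup>2) \<longlonglongrightarrow> 0"
proof (rule tendsto_sandwich[where f="\<lambda>_. 0" and h="\<lambda>N. 2 * t\<^sup>2 * proj_error N + 4 * (pi * t\<^sup>2 * proj_error N)\<^sup>2"])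
  have "(\<lambda>N. 2 * t\<^sup>2 * proj_error N + 4 * (pi * t\<^sup>2 * proj_error N)\<^sup>2) \<longlonglongrightarrow> 2 * t\<^sup>2 * 0 + 4 * (pi * t\<^sup>2 * 0)\<^sup>2"
    by (intro tendsto_intros proj_error_tendsto)
  then show "(\<lambda>N. 2 * t\<^sup>2 * proj_error N + 4 * (pi * t\<^sup>2 * proj_error N)\<^sup>2) \<longlonglongrightarrow> 0" by simp
  have "(LINT \<mu>|leb11. (Gc_rep t \<mu> - Gc_trunc B N t \<mu>)\<^sup>2) \<le> 2 * t\<^sup>2 * proj_error N + 4 * (pi * t\<^sup>2 * proj_error N)\<^sup>2" for N
  proof -
    have i1: "integrable leb11 (\<lambda>\<mu>. (B \<mu> - S N \<mu>)\<^sup>2)"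
      using in_L2_diff[OF B_L2 in_L2_continuous[OF continuous_proj]] by (simp add: in_L2_def)
    have i2: "integrable leb11 (\<lambda>\<mu>. (Gc_rep t \<mu> - Gc_trunc B N t \<mu>)\<^sup>2)"
      using in_L2_diff[OF Gc_rep_in_L2[OF assms] in_L2_continuous[OF continuous_Gc_trunc]] by (simp add: in_L2_def)
    have i3: "integrable leb11 (\<lambda>\<mu>. 2 * (pi * t\<^sup>2 * proj_error N)\<^sup>2)" by (intro leb11_continuous continuous_intros)
    have "(LINT \<mu>|leb11. (Gc_rep t \<mu> - Gc_trunc B N t \<mu>)\<^sup>2)
      \<le> (LINT \<mu>|leb11. 2 * t\<^sup>2 * (B \<mu> - S N \<mu>)\<^sup>2 + 2 * (pi * t\<^sup>2 * proj_error N)\<^sup>2)"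
    proof (intro integral_mono i2)
      fix \<mu> assume "\<mu> \<in> space leb11"
      then have le: "\<bar>Gc_rep t \<mu> - Gc_trunc B N t \<mu>\<bar> \<le> t * \<bar>B \<mu> - S N \<mu>\<bar> + pi * t\<^sup>2 * proj_error N"
        using Gc_rep_diff_le[OF assms] by simp
      define u v where uv: "u = t * \<bar>B \<mu> - S N \<mu>\<bar>" "v = pi * t\<^sup>2 * proj_error N"
      have "\<bar>Gc_rep t \<mu> - Gc_trunc B N t \<mu>\<bar>\<^sup>2 \<le> (u + v)\<^sup>2"
        using le by (intro power_mono) (auto simp: uv)
      also have "\<dots> \<le> 2 * u\<^sup>2 + 2 * v\<^sup>2"
        using zero_le_power2[of "u - v"] by (simp add: power2_sum power2_diff)
      also have "u\<^sup>2 = t\<^sup>2 * (B \<mu> - S N \<mu>)\<^sup>2" by (simp add: uv power_mult_distrib)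
      finally show "(Gc_rep t \<mu> - Gc_trunc B N t \<mu>)\<^sup>2 \<le> 2 * t\<^sup>2 * (B \<mu> - S N \<mu>)\<^sup>2 + 2 * (pi * t\<^sup>2 * proj_error N)\<^sup>2"
        by (simp add: uv)
    qed (use i1 i3 in auto)
    also have "\<dots> = 2 * t\<^sup>2 * proj_error N + 4 * (pi * t\<^sup>2 * proj_error N)\<^sup>2"
      using i1 i3 by (simp add: proj_error_def leb11_const)
    finally show ?thesis .
  qed
  then show "\<forall>\<^sub>F N in sequentially. (LINT \<mu>|leb11. (Gc_rep t \<mu> - Gc_trunc B N t \<mu>)\<^sup>2) \<le> 2 * t\<^sup>2 * proj_error N + 4 * (pi * t\<^sup>2 * proj_error N)\<^sup>2"
    by simp
qed auto

text \<open>
The explicit representative witnesses that the limit chosen in the definition of \<open>Gc\<close> exists.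
\<close>

lemma Gc_spec:
  assumes "t \<ge> 0"
  shows "in_L2 (Gc B t)" "(\<lambda>N. L2_norm (\<lambda>\<mu>. Gc B t \<mu> - Gc_trunc B N t \<mu>)) \<longlonglongrightarrow> 0"
proof -
  have "\<exists>g. in_L2 g \<and> (\<lambda>N. L2_norm (\<lambda>\<mu>. g \<mu> - Gc_trunc B N t \<mu>)) \<longlonglongrightarrow> 0"
    using Gc_rep_in_L2[OF assms] Gc_rep_tendsto[OF assms] unfolding L2_norm_tendsto_0_iff by blast
  then have "in_L2 (Gc B t) \<and> (\<lambda>N. L2_norm (\<lambda>\<mu>. Gc B t \<mu> - Gc_trunc B N t \<mu>)) \<longlonglongrightarrow> 0"
    unfolding Gc_def by (rule someI_ex)
  then show "in_L2 (Gc B t)" "(\<lambda>N. L2_norm (\<lambda>\<mu>. Gc B t \<mu> - Gc_trunc B N t \<mu>)) \<longlonglongrightarrow> 0" by auto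
qed

lemma Gc_AE_eq_rep:
  assumes "t \<ge> 0"
  shows "AE \<mu> in leb11. Gc B t \<mu> = Gc_rep t \<mu>"
proof -
  let ?H = "\<lambda>N. Gc_trunc B N t"
  have H: "in_L2 (?H N)" for N by (rule in_L2_continuous[OF continuous_Gc_trunc])
  have i: "integrable leb11 (\<lambda>\<mu>. (Gc B t \<mu> - ?H N \<mu>)\<^sup>2)" "integrable leb11 (\<lambda>\<mu>. (Gc_rep t \<mu> - ?H N \<mu>)\<^sup>2)"
    "integrable leb11 (\<lambda>\<mu>. (Gc B t \<mu> - Gc_rep t \<mu>)\<^sup>2)" for N
    using in_L2_diff Gc_rep_in_L2[OF assms] Gc_spec(1)[OF assms] H by (auto simp: in_L2_def)
  have le: "(LINT \<mu>|leb11. (Gc B t \<mu> - Gc_rep t \<mu>)\<^sup>2) \<le> 2 * (LINT \<mu>|leb11. (Gc B t \<mu> - ?H N \<mu>)\<^sup>2)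
     + 2 * (LINT \<mu>|leb11. (Gc_rep t \<mu> - ?H N \<mu>)\<^sup>2)" for N
  proof -
    have "(LINT \<mu>|leb11. (Gc B t \<mu> - Gc_rep t \<mu>)\<^sup>2)
      \<le> (LINT \<mu>|leb11. 2 * (Gc B t \<mu> - ?H N \<mu>)\<^sup>2 + 2 * (Gc_rep t \<mu> - ?H N \<mu>)\<^sup>2)"
    proof (intro integral_mono)
      fix \<mu>
      define u v where uv: "u = Gc B t \<mu> - ?H N \<mu>" "v = Gc_rep t \<mu> - ?H N \<mu>"
      have "(u - v)\<^sup>2 \<le> 2 * u\<^sup>2 + 2 * v\<^sup>2"
        using zero_le_power2[of "u + v"] by (simp add: power2_sum power2_diff)
      then show "(Gc B t \<mu> - Gc_rep t \<mu>)\<^sup>2 \<le> 2 * (Gc B t \<mu> - ?H N \<mu>)\<^sup>2 + 2 * (Gc_rep t \<mu> - ?H N \<mu>)\<^sup>2"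
        by (simp add: uv)
    qed (use i in auto)
    then show ?thesis using i by simp
  qed
  have "(\<lambda>N. 2 * (LINT \<mu>|leb11. (Gc B t \<mu> - ?H N \<mu>)\<^sup>2) + 2 * (LINT \<mu>|leb11. (Gc_rep t \<mu> - ?H N \<mu>)\<^sup>2)) \<longlonglongrightarrow> 2 * 0 + 2 * 0"
    using Gc_spec(2)[OF assms] unfolding L2_norm_tendsto_0_iff by (intro tendsto_intros Gc_rep_tendsto assms)
  then have "(LINT \<mu>|leb11. (Gc B t \<mu> - Gc_rep t \<mu>)\<^sup>2) \<le> 2 * 0 + 2 * 0"
    by (rule tendsto_lowerbound) (use le in auto)
  moreover have "(LINT \<mu>|leb11. (Gc B t \<mu> - Gc_rep t \<mu>)\<^sup>2) \<ge> 0" by simp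
  ultimately have "(LINT \<mu>|leb11. (Gc B t \<mu> - Gc_rep t \<mu>)\<^sup>2) = 0" by linarith
  then have "AE \<mu> in leb11. (Gc B t \<mu> - Gc_rep t \<mu>)\<^sup>2 = 0"
    using integral_nonneg_eq_0_iff_AE[OF i(3)] by simp
  then show ?thesis by simp
qed

text \<open>
Only \<open>l = 0\<close> contributes, and \<open>\<lambda>\<^sub>0 = 0\<close>; the total mass is therefore the same for all truncations.
\<close>

lemma integral_Gc_trunc: "(LINT \<mu>|leb11. Gc_trunc B N t \<mu>) = (1 - exp (- K * t)) / (2 * pi)"
proof -
  define a where "a l = (2 * real l + 1) / (4 * pi) * (exp (- lambda_coll B l * t) - exp (- K * t))" for l
  have "(LINT \<mu>|leb11. Gc_trunc B N t \<mu>) = legendre_moment (\<lambda>\<mu>. \<Sum>l<Suc N. a l * legendre l \<mu>) 0"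
    by (simp add: legendre_moment_def Gc_trunc_def a_def lessThan_Suc_atMost del: sum.lessThan_Suc)
  also have "\<dots> = 2 * a 0" by (subst legendre_moment_legendre_sum) simp
  finally show ?thesis by (simp add: a_def lambda_coll_eq) (simp add: field_simps)
qed

text \<open>
All truncations have the same positive integral, and they converge to \<open>G\<^sup>c(t)\<close> in \<open>L\<^sup>1\<close>.
\<close>

lemma L1_norm_Gc_pos:
  assumes "t > 0"
  shows "L1_norm (Gc B t) > 0"
proof -
  have t: "t \<ge> 0" using assms by simp
  let ?c = "(1 - exp (- K * t)) / (2 * pi)"
  have c: "?c > 0" using K_pos assms by simp
  have "(\<lambda>N. L1_norm (\<lambda>\<mu>. Gc B t \<mu> - Gc_trunc B N t \<mu>)) \<longlonglongrightarrow> 0"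
    by (intro L1_tendsto_if_L2_tendsto in_L2_diff Gc_spec t in_L2_continuous continuous_Gc_trunc)
  from order_tendstoD(2)[OF this c] obtain N where N: "L1_norm (\<lambda>\<mu>. Gc B t \<mu> - Gc_trunc B N t \<mu>) < ?c"
    by (auto dest: eventually_happens)
  have i: "integrable leb11 (Gc B t)" "integrable leb11 (Gc_trunc B N t)"
    by (intro in_L2_integrable Gc_spec t in_L2_continuous continuous_Gc_trunc)+
  have "?c = (LINT \<mu>|leb11. Gc_trunc B N t \<mu>)" by (simp only: integral_Gc_trunc)
  also have "\<dots> \<le> (LINT \<mu>|leb11. \<bar>Gc B t \<mu>\<bar> + \<bar>Gc B t \<mu> - Gc_trunc B N t \<mu>\<bar>)"
    using i by (intro integral_mono) auto
  also have "\<dots> = L1_norm (Gc B t) + L1_norm (\<lambda>\<mu>. Gc B t \<mu> - Gc_trunc B N t \<mu>)"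
    using i by (simp add: L1_norm_def)
  finally show ?thesis using N by simp
qed

lemma L1_norm_B_pos: "L1_norm B > 0"
proof -
  have "m 0 \<le> L1_norm B"
    unfolding moment_0 L1_norm_def using in_L2_integrable[OF B_L2] by (intro integral_mono) auto
  with moment_0_pos show ?thesis by simp
qed

theorem Gc_pc_convergence:
  assumes t: "t \<ge> 0"
  shows "(\<lambda>N. L2_norm (\<lambda>\<mu>. Gc B t \<mu> - Gc_trunc B N t \<mu>)
             + L1_norm (\<lambda>\<mu>. pc B t \<mu> - pc_trunc B N t \<mu>)) \<longlonglongrightarrow> 0"
proof -
  have "(\<lambda>N. L1_norm (\<lambda>\<mu>. pc B t \<mu> - pc_trunc B N t \<mu>)) \<longlonglongrightarrow> 0"
  proof (cases "t = 0")
    case True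
    have "(\<lambda>N. L2_norm (\<lambda>\<mu>. B \<mu> - S N \<mu>)) \<longlonglongrightarrow> 0"
      unfolding L2_norm_tendsto_0_iff by (rule legendre_proj_tendsto[OF B_L2])
    then have "(\<lambda>N. L1_norm (\<lambda>\<mu>. B \<mu> / L1_norm B - S N \<mu> / L1_norm (S N))) \<longlonglongrightarrow> 0"
      by (intro L1_norm_normalized_tendsto B_L2 L1_norm_B_pos in_L2_continuous[OF continuous_proj])
    then show ?thesis by (simp add: pc_def pc_trunc_def True)
  next
    case False
    then have "(\<lambda>N. L1_norm (\<lambda>\<mu>. Gc B t \<mu> / L1_norm (Gc B t) - Gc_trunc B N t \<mu> / L1_norm (Gc_trunc B N t))) \<longlonglongrightarrow> 0"
      using t by (intro L1_norm_normalized_tendsto Gc_spec L1_norm_Gc_pos in_L2_continuous[OF continuous_Gc_trunc]) auto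
    then show ?thesis using False by (simp add: pc_def pc_trunc_def)
  qed
  from tendsto_add[OF Gc_spec(2)[OF t] this] show ?thesis by simp
qed

theorem Linf_bound:
  assumes t: "t \<ge> 0" "t \<le> T"
  shows "Linf_norm (\<lambda>\<mu>. Gc B t \<mu> - Gc_trunc B N t \<mu>)
           \<le> ereal T * Linf_norm (\<lambda>\<mu>. B \<mu> - S N \<mu>)
             + ereal (pi * T\<^sup>2 * (L2_norm (\<lambda>\<mu>. B \<mu> - S N \<mu>))\<^sup>2)"
  unfolding Linf_norm_def
proof (rule esssup_I)
  have "in_L2 (\<lambda>\<mu>. Gc B t \<mu> - Gc_trunc B N t \<mu>)"
    by (intro in_L2_diff Gc_spec t in_L2_continuous[OF continuous_Gc_trunc])
  then show "(\<lambda>\<mu>. ereal \<bar>Gc B t \<mu> - Gc_trunc B N t \<mu>\<bar>) \<in> borel_measurable leb11"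
    by (auto dest: in_L2_measurable)
  have "AE \<mu> in leb11. \<mu> \<in> {-1..1}" by (rule AE_I2) simp
  with Gc_AE_eq_rep[OF t(1)] esssup_AE[of "\<lambda>\<mu>. ereal \<bar>B \<mu> - S N \<mu>\<bar>" leb11]
  show "AE \<mu> in leb11. ereal \<bar>Gc B t \<mu> - Gc_trunc B N t \<mu>\<bar> \<le>
      ereal T * esssup leb11 (\<lambda>\<mu>. ereal \<bar>B \<mu> - S N \<mu>\<bar>) + ereal (pi * T\<^sup>2 * (L2_norm (\<lambda>\<mu>. B \<mu> - S N \<mu>))\<^sup>2)"
  proof eventually_elim
    case (elim \<mu>)
    have "\<bar>Gc B t \<mu> - Gc_trunc B N t \<mu>\<bar> \<le> t * \<bar>B \<mu> - S N \<mu>\<bar> + pi * t\<^sup>2 * proj_error N"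
      using Gc_rep_diff_le[OF t(1)] elim by simp
    also have "\<dots> \<le> T * \<bar>B \<mu> - S N \<mu>\<bar> + pi * T\<^sup>2 * proj_error N"
      using t proj_error_nonneg by (intro add_mono mult_right_mono mult_left_mono power_mono) auto
    finally have "ereal \<bar>Gc B t \<mu> - Gc_trunc B N t \<mu>\<bar> \<le> ereal T * ereal \<bar>B \<mu> - S N \<mu>\<bar> + ereal (pi * T\<^sup>2 * proj_error N)"
      by simp
    also have "\<dots> \<le> ereal T * esssup leb11 (\<lambda>\<mu>. ereal \<bar>B \<mu> - S N \<mu>\<bar>) + ereal (pi * T\<^sup>2 * proj_error N)"
      using elim t by (intro add_right_mono ereal_mult_left_mono) auto
    finally show ?case by (simp add: L2_norm_sq proj_error_def)
  qed
qed

theorem Linf_bound_tendsto: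
  assumes "(\<lambda>N. Linf_norm (\<lambda>\<mu>. B \<mu> - S N \<mu>)) \<longlonglongrightarrow> 0"
  shows "(\<lambda>N. ereal T * Linf_norm (\<lambda>\<mu>. B \<mu> - S N \<mu>)
             + ereal (pi * T\<^sup>2 * (L2_norm (\<lambda>\<mu>. B \<mu> - S N \<mu>))\<^sup>2)) \<longlonglongrightarrow> 0"
proof -
  have "(\<lambda>N. pi * T\<^sup>2 * proj_error N) \<longlonglongrightarrow> pi * T\<^sup>2 * 0" by (intro tendsto_intros proj_error_tendsto)
  then have "(\<lambda>N. ereal (pi * T\<^sup>2 * proj_error N)) \<longlonglongrightarrow> ereal 0" by simp
  moreover have "(\<lambda>N. ereal T * Linf_norm (\<lambda>\<mu>. B \<mu> - S N \<mu>)) \<longlonglongrightarrow> ereal T * 0"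
    by (intro tendsto_cmult_ereal assms) simp
  ultimately have "(\<lambda>N. ereal T * Linf_norm (\<lambda>\<mu>. B \<mu> - S N \<mu>) + ereal (pi * T\<^sup>2 * proj_error N)) \<longlonglongrightarrow> ereal T * 0 + ereal 0"
    by (intro tendsto_add_ereal) auto
  then show ?thesis by (simp add: L2_norm_sq proj_error_def)
qed

end

section \<open>Positivity of the truncated Green's function\<close>

text \<open>
The factor \<open>u\<^sup>2\<close> is split off because, for \<open>u\<close> proportional to the \<open>l\<close>-th moment, it is what makes the
sum over \<open>l\<close> with weights \<open>2 l + 1\<close> converge; the other factor is small for large \<open>j\<close>, uniformly in \<open>u\<close>.
\<close>

lemma exp_taylor_remainder_le:
  fixes u U :: real
  assumes "\<bar>u\<bar> \<le> U"
  shows "\<bar>exp u - 1 - (\<Sum>k=1..Suc j. u ^ k / fact k)\<bar> \<le> u\<^sup>2 * (exp U * (U ^ j / fact j))"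
proof -
  obtain t where t: "\<bar>t\<bar> \<le> \<bar>u\<bar>" "exp u = (\<Sum>k<Suc (Suc j). u ^ k / fact k) + exp t / fact (Suc (Suc j)) * u ^ Suc (Suc j)"
    using Maclaurin_exp_le by blast
  have "(\<Sum>k<Suc (Suc j). u ^ k / fact k) = 1 + (\<Sum>k=1..Suc j. u ^ k / fact k)"
    unfolding lessThan_Suc_atMost atMost_atLeast0 by (subst sum.atLeast_Suc_atMost) auto
  then have "exp u - 1 - (\<Sum>k=1..Suc j. u ^ k / fact k) = exp t / fact (Suc (Suc j)) * u ^ Suc (Suc j)"
    using t(2) by linarith
  also have "\<bar>\<dots>\<bar> = u\<^sup>2 * (exp t * (\<bar>u\<bar> ^ j / fact (Suc (Suc j))))"
    by (simp add: abs_mult power_abs power2_eq_square)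
  also have "\<dots> \<le> u\<^sup>2 * (exp U * (U ^ j / fact j))"
  proof (intro mult_left_mono mult_mono frac_le power_mono)
    show "fact j \<le> (fact (Suc (Suc j)) :: real)" by (rule fact_mono) simp
  qed (use t assms in auto)
  finally show ?thesis .
qed

context collision_kernel
begin

text \<open>
Truncation of order \<open>N\<close> of the \<open>k\<close>-th power of \<open>B\<close> under convolution of zonal functions on the sphere,
up to a power of \<open>2\<pi>\<close>: convolution multiplies Legendre coefficients.
\<close>

definition conv_pow :: "nat \<Rightarrow> nat \<Rightarrow> real \<Rightarrow> real" where
  "conv_pow k N x = (\<Sum>l\<le>N. (2 * real l + 1) / 2 * m l ^ k * legendre l x)"

text \<open>
Multiplying the coefficients of \<open>f = \<Sum> a\<^sub>l P\<^sub>l\<close> by the moments of \<open>B\<close> is convolution with \<open>B\<close>: at \<open>x\<close> the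
result is the integral over \<open>y\<close> of \<open>B y\<close> times a spherical average of \<open>f\<close> that is at least \<open>-e\<close>. Since
\<open>B \<ge> 0\<close>, the integral is at least \<open>-e \<integral> B\<close>.
\<close>

lemma multiplier_lower_bound:
  assumes f: "\<And>z. z \<in> {-1..1} \<Longrightarrow> - e \<le> (\<Sum>l\<le>N. a l * legendre l z)" and x: "x \<in> {-1..1}"
  shows "- (e * m 0) \<le> (\<Sum>l\<le>N. a l * m l * legendre l x)"
proof -
  define T where "T y = (\<Sum>l\<le>N. a l * (legendre l x * legendre l y))" for y
  have T: "in_L2 T" unfolding T_def by (intro in_L2_continuous continuous_intros)
  have "- (e * m 0) = (LINT y|leb11. B y * (- e))" by (simp add: moment_0)
  also have "\<dots> \<le> (LINT y|leb11. B y * T y)"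
  proof (rule integral_mono_AE)
    have "AE y in leb11. y \<in> {-1..1}" by (rule AE_I2) simp
    with B_nonneg show "AE y in leb11. B y * (- e) \<le> B y * T y"
    proof eventually_elim
      case (elim y)
      then show ?case unfolding T_def by (intro mult_left_mono legendre_translate_lower_bound f x) auto
    qed
  qed (intro in_L2_mult_integrable B_L2 T in_L2_continuous continuous_intros)+
  also have "\<dots> = (LINT y|leb11. (\<Sum>l\<le>N. a l * legendre l x * (B y * legendre l y)))"
    by (simp add: T_def sum_distrib_left mult_ac)
  also have "\<dots> = (\<Sum>l\<le>N. LINT y|leb11. a l * legendre l x * (B y * legendre l y))"
    by (intro Bochner_Integration.integral_sum integrable_mult_right in_L2_mult_integrable B_L2 in_L2_legendre)
  also have "\<dots> = (\<Sum>l\<le>N. a l * legendre l x * m l)"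
    by (simp add: legendre_moment_def)
  also have "\<dots> = (\<Sum>l\<le>N. a l * m l * legendre l x)"
    by (simp add: mult_ac)
  finally show ?thesis .
qed

text \<open>
For \<open>k = 1\<close> this is \<open>B \<ge> 0\<close> together with uniform convergence of the projections; passing from \<open>k\<close> to
\<open>k + 1\<close> is a convolution with \<open>B\<close>. A small negative error has to be allowed because truncations of
nonnegative functions need not be nonnegative.
\<close>

lemma conv_pow_eventually_ge:
  assumes unif: "(\<lambda>N. Linf_norm (\<lambda>\<mu>. B \<mu> - S N \<mu>)) \<longlonglongrightarrow> 0" and "k \<ge> 1"
  shows "e > 0 \<Longrightarrow> \<forall>\<^sub>F N in sequentially. \<forall>x\<in>{-1..1}. - e \<le> conv_pow k N x"
  using \<open>k \<ge> 1\<close>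
proof (induction k arbitrary: e rule: nat_induct_at_least)
  case base
  have "\<forall>\<^sub>F N in sequentially. Linf_norm (\<lambda>\<mu>. B \<mu> - S N \<mu>) < ereal e"
    using base by (intro order_tendstoD[OF unif]) auto
  then show ?case
  proof eventually_elim
    case (elim N)
    have "AE \<mu> in leb11. - e \<le> S N \<mu>"
      using esssup_AE[of "\<lambda>\<mu>. ereal \<bar>B \<mu> - S N \<mu>\<bar>" leb11] B_nonneg
    proof eventually_elim
      case (elim \<mu>)
      then have "ereal \<bar>B \<mu> - S N \<mu>\<bar> < ereal e"
        using \<open>Linf_norm (\<lambda>\<mu>. B \<mu> - S N \<mu>) < ereal e\<close> unfolding Linf_norm_def by (blast intro: le_less_trans)
      with elim show ?case by simp
    qed
    then have "- e \<le> S N x" if "x \<in> {-1..1}" for x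
      using that by (intro AE_leb11_ge_imp_ge[OF continuous_proj])
    moreover have "S N x = conv_pow 1 N x" for x
      by (simp add: legendre_proj_def conv_pow_def legendre_coeff_eq)
    ultimately show ?case by simp
  qed
next
  case (Suc k)
  have "e / m 0 > 0" using Suc.prems moment_0_pos by simp
  from Suc.IH[OF this] show ?case
  proof eventually_elim
    case (elim N)
    show ?case
    proof
      fix x :: real assume "x \<in> {-1..1}"
      from multiplier_lower_bound[where e="e / m 0" and N=N and a="\<lambda>l. (2 * real l + 1) / 2 * m l ^ k", OF _ this] elim
      show "- e \<le> conv_pow (Suc k) N x"
        using moment_0_pos by (simp add: conv_pow_def mult_ac)
    qed
  qed
qed

text \<open>
The strict inequalities \<open>\<bar>m l\<bar> < m 0\<close> become uniform in \<open>l \<ge> 1\<close> because the moments tend to \<open>0\<close>, so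
that only finitely many of them matter.
\<close>

lemma moment_gap: "\<exists>\<rho>. 0 \<le> \<rho> \<and> \<rho> < 1 \<and> (\<forall>l\<ge>1. \<bar>m l\<bar> \<le> \<rho> * m 0)"
proof -
  have "(\<lambda>l. \<bar>m l\<bar>) \<longlonglongrightarrow> 0" using tendsto_rabs[OF moment_tendsto_0] by simp
  then have "\<forall>\<^sub>F l in sequentially. \<bar>m l\<bar> < m 0 / 2" using moment_0_pos by (intro order_tendstoD) auto
  then obtain L where L: "\<And>l. l \<ge> L \<Longrightarrow> \<bar>m l\<bar> < m 0 / 2" by (auto simp: eventually_sequentially)
  define \<rho> where "\<rho> = Max (insert (1/2) ((\<lambda>l. \<bar>m l\<bar> / m 0) ` {1..<L}))"
  have le: "\<bar>m l\<bar> / m 0 \<le> \<rho>" if "l \<ge> 1" for l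
  proof (cases "l < L")
    case True
    with that show ?thesis unfolding \<rho>_def by (intro Max_ge) auto
  next
    case False
    then have "\<bar>m l\<bar> / m 0 \<le> 1/2" using L[of l] moment_0_pos by (simp add: field_simps)
    also have "\<dots> \<le> \<rho>" unfolding \<rho>_def by (intro Max_ge) auto
    finally show ?thesis .
  qed
  have "\<rho> < 1" unfolding \<rho>_def using abs_moment_less moment_0_pos by (subst Max_less_iff) auto
  moreover have "0 \<le> \<rho>" using le[of 1] moment_0_pos by (meson abs_ge_zero divide_nonneg_pos le_refl order.trans)
  moreover have "\<bar>m l\<bar> \<le> \<rho> * m 0" if "l \<ge> 1" for l
    using le[OF that] moment_0_pos by (simp add: field_simps)
  ultimately show ?thesis by blast
qed

text \<open>
For \<open>k = j + 2\<close> the terms with \<open>l \<ge> 1\<close> add up to at most \<open>(\<rho> \<cdot> m 0)^j \<parallel>B\<parallel>\<^sub>2\<^sup>2\<close>: two of the \<open>k\<close> factors \<open>m l\<close>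
are kept to make the sum over \<open>l\<close> converge by Bessel's inequality. As \<open>\<rho> < 1\<close>, this is at most half of the
constant term \<open>(m 0)^k / 2\<close> once \<open>j\<close> is large.
\<close>

lemma conv_pow_uniformly_positive:
  "\<exists>k\<ge>1. \<exists>\<eta>>0. \<forall>N. \<forall>x\<in>{-1..1}. \<eta> \<le> conv_pow k N x"
proof -
  obtain \<rho> where \<rho>: "0 \<le> \<rho>" "\<rho> < 1" "\<And>l. l \<ge> 1 \<Longrightarrow> \<bar>m l\<bar> \<le> \<rho> * m 0" using moment_gap by blast
  define A where "A = (LINT x|leb11. (B x)\<^sup>2)"
  have "(\<lambda>j. \<rho> ^ j * A) \<longlonglongrightarrow> 0 * A" using \<rho> by (intro tendsto_mult LIMSEQ_power_zero tendsto_const) auto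
  then have "\<forall>\<^sub>F j in sequentially. \<rho> ^ j * A < (m 0)\<^sup>2 / 4" using moment_0_pos by (intro order_tendstoD) auto
  then obtain j where j: "\<rho> ^ j * A < (m 0)\<^sup>2 / 4" by (auto dest: eventually_happens)
  define k where "k = j + 2"
  have "m 0 ^ k / 4 \<le> conv_pow k N x" if x: "x \<in> {-1..1}" for N x
  proof -
    define g where "g l = (2 * real l + 1) / 2 * m l ^ k * legendre l x" for l
    have g: "\<bar>g l\<bar> \<le> (\<rho> * m 0) ^ j * energy l" if "l \<ge> 1" for l
    proof -
      have "\<bar>g l\<bar> = (\<bar>m l\<bar> ^ j * energy l) * \<bar>legendre l x\<bar>"
        by (simp add: g_def energy_def k_def abs_mult power_add power_abs flip: power2_eq_square)
      also have "\<dots> \<le> ((\<rho> * m 0) ^ j * energy l) * 1"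
        using \<rho> moment_0_pos that by (intro mult_mono power_mono abs_legendre_le_1 x) (auto simp: energy_nonneg)
      finally show ?thesis by simp
    qed
    have "\<bar>\<Sum>l=1..N. g l\<bar> \<le> (\<Sum>l=1..N. (\<rho> * m 0) ^ j * energy l)"
      by (intro order.trans[OF sum_abs] sum_mono g) auto
    also have "\<dots> = (\<rho> * m 0) ^ j * (\<Sum>l=1..N. energy l)" by (simp add: sum_distrib_left)
    also have "\<dots> \<le> (\<rho> * m 0) ^ j * A"
    proof (intro mult_left_mono)
      have "(\<Sum>l=1..N. energy l) \<le> (\<Sum>l<Suc N. energy l)" by (intro sum_mono2) (auto simp: energy_nonneg)
      also have "\<dots> \<le> A" unfolding A_def by (rule sum_energy_le)
      finally show "(\<Sum>l=1..N. energy l) \<le> A" .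
    qed (use \<rho> moment_0_pos in auto)
    also have "\<dots> = m 0 ^ j * (\<rho> ^ j * A)" by (simp add: power_mult_distrib)
    also have "\<dots> \<le> m 0 ^ j * ((m 0)\<^sup>2 / 4)" using j moment_0_pos by (intro mult_left_mono) auto
    also have "\<dots> = m 0 ^ k / 4" by (simp add: k_def power_add power2_eq_square)
    finally have "\<bar>\<Sum>l=1..N. g l\<bar> \<le> m 0 ^ k / 4" .
    moreover have "conv_pow k N x = m 0 ^ k / 2 + (\<Sum>l=1..N. g l)"
      unfolding conv_pow_def atMost_atLeast0 by (subst sum.atLeast_Suc_atMost) (auto simp: g_def)
    ultimately show ?thesis by linarith
  qed
  moreover have "m 0 ^ k / 4 > 0" "k \<ge> 1" using moment_0_pos by (auto simp: k_def)
  ultimately show ?thesis by blast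
qed

text \<open>
Taylor expansion to order \<open>M\<close> of each exponential; the Taylor terms of degree \<open>k\<close> combine to the
\<open>k\<close>-th convolution power.
\<close>

lemma Gc_trunc_expansion:
  "Gc_trunc B N t x = exp (- K * t) *
    ((\<Sum>k=1..M. (2 * pi * t) ^ k / fact k / (2 * pi) * conv_pow k N x)
     + (\<Sum>l\<le>N. (2 * real l + 1) / (4 * pi) * (exp (2 * pi * m l * t) - 1 - (\<Sum>k=1..M. (2 * pi * m l * t) ^ k / fact k)) * legendre l x))"
proof -
  have "(\<Sum>k=1..M. (2 * pi * t) ^ k / fact k / (2 * pi) * conv_pow k N x)
     = (\<Sum>k=1..M. \<Sum>l\<le>N. (2 * real l + 1) / (4 * pi) * ((2 * pi * m l * t) ^ k / fact k) * legendre l x)"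
    unfolding conv_pow_def sum_distrib_left
    by (intro sum.cong refl) (simp add: power_mult_distrib field_simps)
  also have "\<dots> = (\<Sum>l\<le>N. \<Sum>k=1..M. (2 * real l + 1) / (4 * pi) * ((2 * pi * m l * t) ^ k / fact k) * legendre l x)"
    by (rule sum.swap)
  also have "\<dots> = (\<Sum>l\<le>N. (2 * real l + 1) / (4 * pi) * (\<Sum>k=1..M. (2 * pi * m l * t) ^ k / fact k) * legendre l x)"
    by (simp add: sum_distrib_left sum_distrib_right)
  finally have swap: "(\<Sum>k=1..M. (2 * pi * t) ^ k / fact k / (2 * pi) * conv_pow k N x)
     = (\<Sum>l\<le>N. (2 * real l + 1) / (4 * pi) * (\<Sum>k=1..M. (2 * pi * m l * t) ^ k / fact k) * legendre l x)" .
  have "a * (E - 1) * P = a * F * P + a * (E - 1 - F) * P" for a E F P :: real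
    by (simp add: algebra_simps)
  then show ?thesis
    unfolding Gc_trunc_eq swap sum.distrib[symmetric] by (intro arg_cong2[where f="(*)"] sum.cong refl)
qed

text \<open>
Let \<open>q > 0\<close> be the lower bound which the uniformly positive convolution power contributes for all
\<open>t \<ge> \<delta>\<close>. The Taylor order is chosen so that the remainder is at most \<open>q/4\<close> uniformly in the
truncation order, and then the truncation order so large that the finitely many other convolution
powers together contribute at least \<open>-q/4\<close>. At least \<open>q/2\<close> is left.
\<close>

lemma Gc_trunc_eventually_pos:
  assumes unif: "(\<lambda>N. Linf_norm (\<lambda>\<mu>. B \<mu> - S N \<mu>)) \<longlonglongrightarrow> 0" and \<delta>: "0 < \<delta>"
  shows "\<forall>\<^sub>F N in sequentially. \<forall>t\<in>{\<delta>..T}. \<forall>x\<in>{-1..1}. 0 < Gc_trunc B N t x"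
proof -
  obtain k\<^sub>0 \<eta> where k0: "k\<^sub>0 \<ge> 1" and \<eta>: "\<eta> > 0" "\<And>N x. x \<in> {-1..1} \<Longrightarrow> \<eta> \<le> conv_pow k\<^sub>0 N x"
    using conv_pow_uniformly_positive by blast
  define A where "A = (LINT x|leb11. (B x)\<^sup>2)"
  define q where "q = (2 * pi * \<delta>) ^ k\<^sub>0 / fact k\<^sub>0 / (2 * pi) * \<eta>"
  have q: "q > 0" using \<delta> \<eta> by (simp add: q_def)
  define U where "U = K * T"
  define C where "C = 2 * pi * T\<^sup>2 * A * exp U"
  have "(\<lambda>j. C * (U ^ j / fact j)) \<longlonglongrightarrow> C * 0"
    using summable_LIMSEQ_zero[OF summable_exp[of U]]
    by (intro tendsto_mult tendsto_const) (simp add: divide_inverse mult.commute)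
  then have "\<forall>\<^sub>F j in sequentially. C * (U ^ j / fact j) < q / 4" using q by (intro order_tendstoD) auto
  then have "\<forall>\<^sub>F j in sequentially. C * (U ^ j / fact j) < q / 4 \<and> j \<ge> k\<^sub>0"
    by (intro eventually_conj eventually_ge_at_top)
  then obtain j where j: "C * (U ^ j / fact j) < q / 4" "j \<ge> k\<^sub>0" by (auto dest: eventually_happens)
  \<comment> \<open>\<open>W\<close> bounds the total weight of the convolution powers for all \<open>t \<le> T\<close>. The absolute value covers
    a negative \<open>T\<close>, for which the range of \<open>t\<close> is empty.\<close>
  define W where "W = (\<Sum>k=1..Suc j. \<bar>2 * pi * T\<bar> ^ k / fact k / (2 * pi))"
  have W: "W \<ge> 0" unfolding W_def by (intro sum_nonneg) auto
  define e where "e = q / (4 * (W + 1))"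
  have e: "e > 0" using q W by (simp add: e_def)
  have "\<forall>\<^sub>F N in sequentially. \<forall>k\<in>{1..Suc j}. \<forall>x\<in>{-1..1}. - e \<le> conv_pow k N x"
    by (intro eventually_ball_finite ballI conv_pow_eventually_ge unif e) auto
  then show ?thesis
  proof eventually_elim
    case (elim N)
    show ?case
    proof (intro ballI)
      fix t x :: real assume t: "t \<in> {\<delta>..T}" and x: "x \<in> {-1..1}"
      define c where "c k = (2 * pi * t) ^ k / fact k / (2 * pi)" for k
      have c0: "c k \<ge> 0" for k using t \<delta> by (simp add: c_def)
      have cW: "c k \<le> \<bar>2 * pi * T\<bar> ^ k / fact k / (2 * pi)" for k
        unfolding c_def using t \<delta> by (intro divide_right_mono power_mono) auto
      have "q \<le> c k\<^sub>0 * conv_pow k\<^sub>0 N x"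
        unfolding q_def c_def using t \<delta> \<eta> x
        by (intro mult_mono divide_right_mono power_mono) (auto intro: less_imp_le)
      moreover have "- (q / 4) \<le> (\<Sum>k\<in>{1..Suc j} - {k\<^sub>0}. c k * conv_pow k N x)"
      proof -
        have "e * (\<Sum>k\<in>{1..Suc j} - {k\<^sub>0}. c k) \<le> e * W"
        proof (intro mult_left_mono)
          have "(\<Sum>k\<in>{1..Suc j} - {k\<^sub>0}. c k) \<le> (\<Sum>k=1..Suc j. c k)"
            by (intro sum_mono2) (auto simp: c0)
          also have "\<dots> \<le> W" unfolding W_def by (intro sum_mono cW)
          finally show "(\<Sum>k\<in>{1..Suc j} - {k\<^sub>0}. c k) \<le> W" .
        qed (use e in auto)
        also have "e * W \<le> q / 4" using q W by (simp add: e_def field_simps)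
        finally have "- (q / 4) \<le> (\<Sum>k\<in>{1..Suc j} - {k\<^sub>0}. c k * (- e))"
          by (simp add: sum_distrib_left sum_negf mult.commute)
        also have "\<dots> \<le> (\<Sum>k\<in>{1..Suc j} - {k\<^sub>0}. c k * conv_pow k N x)"
          using elim x c0 by (intro sum_mono mult_left_mono) auto
        finally show ?thesis .
      qed
      moreover have "(\<Sum>k=1..Suc j. c k * conv_pow k N x)
          = c k\<^sub>0 * conv_pow k\<^sub>0 N x + (\<Sum>k\<in>{1..Suc j} - {k\<^sub>0}. c k * conv_pow k N x)"
        using k0 j by (intro sum.remove) auto
      moreover define h where "h l = (2 * real l + 1) / (4 * pi) * (exp (2 * pi * m l * t) - 1
          - (\<Sum>k=1..Suc j. (2 * pi * m l * t) ^ k / fact k)) * legendre l x" for l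
      have "\<bar>\<Sum>l\<le>N. h l\<bar> \<le> q / 4"
      proof -
        have h: "\<bar>h l\<bar> \<le> 2 * pi * T\<^sup>2 * (exp U * (U ^ j / fact j)) * energy l" for l
        proof -
          define u where "u = 2 * pi * m l * t"
          have "\<bar>u\<bar> = 2 * pi * \<bar>m l\<bar> * t" using t \<delta> by (simp add: u_def abs_mult)
          also have "\<dots> \<le> 2 * pi * m 0 * T"
            using t \<delta> moment_0_pos by (intro mult_mono mult_left_mono abs_moment_le) auto
          finally have u: "\<bar>u\<bar> \<le> U" by (simp add: U_def K_coll_eq)
          then have U: "0 \<le> U" by linarith
          have "\<bar>h l\<bar> = (2 * real l + 1) / (4 * pi) * \<bar>exp u - 1 - (\<Sum>k=1..Suc j. u ^ k / fact k)\<bar> * \<bar>legendre l x\<bar>"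
            by (simp add: h_def u_def abs_mult)
          also have "\<dots> \<le> (2 * real l + 1) / (4 * pi) * (u\<^sup>2 * (exp U * (U ^ j / fact j))) * 1"
            using U by (intro mult_mono mult_left_mono exp_taylor_remainder_le u abs_legendre_le_1 x) auto
          also have "\<dots> = 2 * pi * t\<^sup>2 * (exp U * (U ^ j / fact j)) * energy l"
            by (simp add: u_def energy_def power2_eq_square field_simps)
          also have "\<dots> \<le> 2 * pi * T\<^sup>2 * (exp U * (U ^ j / fact j)) * energy l"
            using t \<delta> U energy_nonneg by (intro mult_right_mono mult_left_mono power_mono) auto
          finally show ?thesis .
        qed
        have "(\<Sum>l<Suc N. energy l) \<le> A" unfolding A_def by (rule sum_energy_le)
        moreover have "0 \<le> 2 * pi * T\<^sup>2 * (exp U * (U ^ j / fact j))"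
          using t \<delta> K_pos by (simp add: U_def)
        ultimately have "2 * pi * T\<^sup>2 * (exp U * (U ^ j / fact j)) * (\<Sum>l<Suc N. energy l)
            \<le> 2 * pi * T\<^sup>2 * (exp U * (U ^ j / fact j)) * A" by (rule mult_left_mono)
        also have "\<dots> = C * (U ^ j / fact j)" by (simp add: C_def)
        also have "\<dots> \<le> q / 4" using j by simp
        finally have "(\<Sum>l\<le>N. 2 * pi * T\<^sup>2 * (exp U * (U ^ j / fact j)) * energy l) \<le> q / 4"
          by (simp add: sum_distrib_left lessThan_Suc_atMost del: sum.lessThan_Suc)
        then show ?thesis by (intro order.trans[OF order.trans[OF sum_abs sum_mono[OF h]]])
      qed
      ultimately have "0 < (\<Sum>k=1..Suc j. c k * conv_pow k N x) + (\<Sum>l\<le>N. h l)" using q by linarith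
      then show "0 < Gc_trunc B N t x"
        unfolding Gc_trunc_expansion[of N t x "Suc j"] c_def h_def by (simp only: mult_pos_pos exp_gt_zero)
    qed
  qed
qed

text \<open>
The normalizing constant is positive because the truncation has positive integral.
\<close>

lemma pc_trunc_pos:
  assumes "t > 0" "0 < Gc_trunc B N t x"
  shows "0 < pc_trunc B N t x"
proof -
  have "0 < (1 - exp (- K * t)) / (2 * pi)" using K_pos assms by simp
  also have "\<dots> = (LINT \<mu>|leb11. Gc_trunc B N t \<mu>)" by (simp only: integral_Gc_trunc)
  also have "\<dots> \<le> L1_norm (Gc_trunc B N t)"
    unfolding L1_norm_def using in_L2_integrable[OF in_L2_continuous[OF continuous_Gc_trunc]]
    by (intro integral_mono) auto
  finally show ?thesis using assms by (simp add: pc_trunc_def)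
qed

end

section \<open>Convergence and positivity of the truncations\<close>

theorem theorem4p1:
  fixes B :: "real \<Rightarrow> real" and T :: real
  assumes B_L2: "in_L2 B"
    and B_nonneg: "AE \<mu> in leb11. B \<mu> \<ge> 0"
    and B_nonzero: "\<not> (AE \<mu> in leb11. B \<mu> = 0)"
    and T_pos: "T > 0"
  shows
    "(\<forall>t\<in>{0..T}.
        (\<lambda>N. L2_norm (\<lambda>\<mu>. Gc B t \<mu> - Gc_trunc B N t \<mu>)
             + L1_norm (\<lambda>\<mu>. pc B t \<mu> - pc_trunc B N t \<mu>)) \<longlonglongrightarrow> 0)
     \<and>
     ((\<lambda>N. Linf_norm (\<lambda>\<mu>. B \<mu> - legendre_proj B N \<mu>)) \<longlonglongrightarrow> 0
      \<longrightarrow>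
        (\<forall>N. \<forall>t\<in>{0..T}.
           Linf_norm (\<lambda>\<mu>. Gc B t \<mu> - Gc_trunc B N t \<mu>)
           \<le> ereal T * Linf_norm (\<lambda>\<mu>. B \<mu> - legendre_proj B N \<mu>)
             + ereal (pi * T\<^sup>2 * (L2_norm (\<lambda>\<mu>. B \<mu> - legendre_proj B N \<mu>))\<^sup>2))
        \<and> (\<lambda>N. ereal T * Linf_norm (\<lambda>\<mu>. B \<mu> - legendre_proj B N \<mu>)
             + ereal (pi * T\<^sup>2 * (L2_norm (\<lambda>\<mu>. B \<mu> - legendre_proj B N \<mu>))\<^sup>2))
          \<longlonglongrightarrow> 0
        \<and> (\<forall>\<delta>. 0 < \<delta> \<and> \<delta> < T \<longrightarrow>
             (\<exists>N. \<forall>n>N. \<forall>t\<in>{\<delta>..T}. \<forall>\<mu>\<in>{-1..1}.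
                Gc_trunc B n t \<mu> > 0 \<and> pc_trunc B n t \<mu> > 0)))"
proof -
  interpret collision_kernel B by standard fact+
  have pos: "\<exists>N. \<forall>n>N. \<forall>t\<in>{\<delta>..T}. \<forall>\<mu>\<in>{-1..1}. Gc_trunc B n t \<mu> > 0 \<and> pc_trunc B n t \<mu> > 0"
    if unif: "(\<lambda>N. Linf_norm (\<lambda>\<mu>. B \<mu> - legendre_proj B N \<mu>)) \<longlonglongrightarrow> 0" and \<delta>: "0 < \<delta>" for \<delta>
  proof -
    obtain N where N: "\<And>n t x. n \<ge> N \<Longrightarrow> t \<in> {\<delta>..T} \<Longrightarrow> x \<in> {-1..1} \<Longrightarrow> 0 < Gc_trunc B n t x"
      using Gc_trunc_eventually_pos[OF unif \<delta>, of T] unfolding eventually_sequentially by blast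
    show ?thesis
    proof (intro exI[of _ N] allI impI ballI conjI)
      fix n t \<mu> assume *: "n > N" "t \<in> {\<delta>..T}" "\<mu> \<in> {-1..1::real}"
      then show "0 < Gc_trunc B n t \<mu>" by (intro N) auto
      then show "0 < pc_trunc B n t \<mu>" using * \<delta> by (intro pc_trunc_pos) auto
    qed
  qed
  show ?thesis
    using Gc_pc_convergence Linf_bound Linf_bound_tendsto pos by auto
qed

end
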